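(* Let $C$ be a strict 2-groupoid and let $Z : P_2(\mathbb{R}^2) \to C$ be a strict 2-functor (an extended FQFT on 2-dimensional Minkowski space). Then the assignment $\mathcal{A}_Z$, given on causal subsets $O$ by $\mathcal{A}_Z(O) = \mathrm{End}_C(Z(\gamma_O))$, with $\gamma_O$ the past boundary path of $O$, and on inclusions $O' \subset O$ by $a \mapsto Z(f')\circ a' \circ Z(f')^{-1}$ (all notation as defined in the context), is a functor $\mathcal{A}_Z : S(\mathbb{R}^2) \to \mathrm{Monoids}$ which is a net of local monoids satisfying the time slice axiom.
   Context: **Causal subsets.** $\mathbb{R}^2$ carries the standard Minkowski metric, with coordinates $(x,t)$, $x$ pointing to the right and $t$ to the future; the lightlike directions are $\pm(1,1)$ and $\pm(1,-1)$. A causal subset is the (non-empty) interior of the intersection of the future of one point with the past of another: an open rectangle all of whose sides are lightlike. It has a left corner, a right corner, a bottom (past) vertex and a top (future) vertex. $S(\mathbb{R}^2)$ is the category (poset) whose objects are causal subsets and whose morphisms are inclusions. Two causal subsets $O_1,O_2$ are spacelike separated if all pairs of points in $O_1\times O_2$ are spacelike separated. **Nets.** Monoids are sets with an associative unital product. A functor $\mathcal{A} : S(\mathbb{R}^2)\to \mathrm{Monoids}$ is a *net of monoids* if it sends all morphisms to injections of monoids. It is a *net of local monoids* if moreover for all spacelike separated $O_1,O_2\subset O$ the images of $\mathcal{A}(O_1)$ and $\mathcal{A}(O_2)$ in $\mathcal{A}(O)$ commute with each other elementwise. It satisfies the *time slice axiom* if for any causal subset $O$, any Cauchy surface in $O$,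 and any collection of causal subsets $\{O'_i\subset O\}$ covering the Cauchy surface, $\bigcup_i \mathcal{A}(O'_i)=\mathcal{A}(O)$, the union being taken in $\mathcal{A}(O)$. A Cauchy surface of a region is a codimension-1 manifold such that all timelike or lightlike curves through the region cross it exactly once. **The 2-category $P_2(\mathbb{R}^2)$.** It is the strict 2-category whose objects are the points of $\mathbb{R}^2$, whose 1-morphisms are piecewise lightlike right-moving paths (composition is concatenation), and whose 2-morphisms are generated, under gluing along pieces of joint boundary, from the closures of causal subsets; the closure of a causal subset with left corner $p$ and right corner $q$ is regarded as a 2-morphism from its future boundary path $p\to q$ (through the top vertex) to its past boundary path $p\to q$ (through the bottom vertex). Thus 2-morphisms are the regions so obtained by gluing (identities being the degenerate regions), and composition is by gluing regions. A strict 2-groupoid is a strict 2-category in which all 1-morphisms and all 2-morphisms are invertible. Vertical composition of 2-morphisms is denoted $\circ$. "Whiskering" means horizontal composition with identity 2-morphisms. For a 1-morphism $h$ of $C$, $\mathrm{End}_C(h)$ is the monoid of 2-morphisms $h\Rightarrow h$ under vertical composition. **Definition of $\mathcal{A}_Z$.** For a causal subset $O$ with left corner $p$, right corner $q$ and bottom vertex $m$, let $\gamma_O = (p\to m\to q)$ be its past boundary and $\mathcal{A}_Z(O):=\mathrm{End}_C(Z(\gamma_O))$. For an inclusion $O'\subset O$, where $O'$ has left corner $p'$, right corner $q'$ and bottom vertex $m'$, let $u$ be the point on the segment $p\to m$ such that $u\to p'$ is a (possibly degenerate) lightlike segment in direction $(1,1)$, and let $v$ be the point on the segment $m\to q$ such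 that $q'\to v$ is a (possibly degenerate) lightlike segment in direction $(1,-1)$. Let $f$ be the 2-morphism in $P_2(\mathbb{R}^2)$ from $u\to p'\to m'\to q'\to v$ to $u\to m\to v$ given by the region between these two paths, and let $f'$ be the whiskering of $f$ by $p\to u$ and $v\to q$. For $a\in \mathrm{End}_C(Z(p'\to m'\to q'))$ let $a'$ be the whiskering of $a$ by $Z(p\to u\to p')$ on one side and by $Z(q'\to v\to q)$ on the other. Then $\mathcal{A}_Z(O'\subset O)$ is the map $$a\mapsto Z(f')\circ a'\circ Z(f')^{-1}\in \mathrm{End}_C(Z(p\to m\to q)).$$ *)

theory Defs
  imports "HOL-Analysis.Analysis" "HOL-Algebra.Group"
begin

section \<open>Strict 2-categories, 2-groupoids and 2-functors\<close>

text \<open>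
  Compositions along objects (\<open>comp1\<close>, \<open>hcomp\<close>) are written in diagrammatic order:
  \<open>f \<cdot> g\<close> is defined if the target of \<open>f\<close> is the source of \<open>g\<close>.
  Vertical composition is written in functional order: \<open>\<beta> \<odot> \<alpha>\<close> is ``first \<open>\<alpha>\<close>, then \<open>\<beta>\<close>''.
  The operations are only meaningful on the carriers \<open>objs\<close>, \<open>arrs\<close>, \<open>cells\<close>.
\<close>

record ('o, 'a, 'c) two_category =
  objs :: "'o set"
  arrs :: "'a set"
  cells :: "'c set"
  src1 :: "'a \<Rightarrow> 'o"
  tgt1 :: "'a \<Rightarrow> 'o"
  src2 :: "'c \<Rightarrow> 'a"
  tgt2 :: "'c \<Rightarrow> 'a"
  id1 :: "'o \<Rightarrow> 'a"
  id2 :: "'a \<Rightarrow> 'c"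
  comp1 :: "'a \<Rightarrow> 'a \<Rightarrow> 'a"  (infixl "\<cdot>\<index>" 70)
  vcomp :: "'c \<Rightarrow> 'c \<Rightarrow> 'c"  (infixl "\<odot>\<index>" 65)
  hcomp :: "'c \<Rightarrow> 'c \<Rightarrow> 'c"  (infixl "\<star>\<index>" 70)

locale strict_2_category =
  fixes C :: "('o, 'a, 'c) two_category" (structure)
  assumes src1_closed: "f \<in> arrs C \<Longrightarrow> src1 C f \<in> objs C"
    and tgt1_closed: "f \<in> arrs C \<Longrightarrow> tgt1 C f \<in> objs C"
    and id1_closed: "x \<in> objs C \<Longrightarrow> id1 C x \<in> arrs C"
    and src1_id1: "x \<in> objs C \<Longrightarrow> src1 C (id1 C x) = x"
    and tgt1_id1: "x \<in> objs C \<Longrightarrow> tgt1 C (id1 C x) = x"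
    and comp1_closed: "\<lbrakk>f \<in> arrs C; g \<in> arrs C; tgt1 C f = src1 C g\<rbrakk> \<Longrightarrow> f \<cdot> g \<in> arrs C"
    and src1_comp1: "\<lbrakk>f \<in> arrs C; g \<in> arrs C; tgt1 C f = src1 C g\<rbrakk> \<Longrightarrow> src1 C (f \<cdot> g) = src1 C f"
    and tgt1_comp1: "\<lbrakk>f \<in> arrs C; g \<in> arrs C; tgt1 C f = src1 C g\<rbrakk> \<Longrightarrow> tgt1 C (f \<cdot> g) = tgt1 C g"
    and comp1_id1_left: "f \<in> arrs C \<Longrightarrow> id1 C (src1 C f) \<cdot> f = f"
    and comp1_id1_right: "f \<in> arrs C \<Longrightarrow> f \<cdot> id1 C (tgt1 C f) = f"
    and comp1_assoc:
      "\<lbrakk>f \<in> arrs C; g \<in> arrs C; h \<in> arrs C; tgt1 C f = src1 C g; tgt1 C g = src1 C h\<rbrakk>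
        \<Longrightarrow> (f \<cdot> g) \<cdot> h = f \<cdot> (g \<cdot> h)"
    and src2_closed: "\<alpha> \<in> cells C \<Longrightarrow> src2 C \<alpha> \<in> arrs C"
    and tgt2_closed: "\<alpha> \<in> cells C \<Longrightarrow> tgt2 C \<alpha> \<in> arrs C"
    and src1_globular: "\<alpha> \<in> cells C \<Longrightarrow> src1 C (src2 C \<alpha>) = src1 C (tgt2 C \<alpha>)"
    and tgt1_globular: "\<alpha> \<in> cells C \<Longrightarrow> tgt1 C (src2 C \<alpha>) = tgt1 C (tgt2 C \<alpha>)"
    and id2_closed: "f \<in> arrs C \<Longrightarrow> id2 C f \<in> cells C"
    and src2_id2: "f \<in> arrs C \<Longrightarrow> src2 C (id2 C f) = f"
    and tgt2_id2: "f \<in> arrs C \<Longrightarrow> tgt2 C (id2 C f) = f"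
    and vcomp_closed: "\<lbrakk>\<alpha> \<in> cells C; \<beta> \<in> cells C; tgt2 C \<alpha> = src2 C \<beta>\<rbrakk> \<Longrightarrow> \<beta> \<odot> \<alpha> \<in> cells C"
    and src2_vcomp: "\<lbrakk>\<alpha> \<in> cells C; \<beta> \<in> cells C; tgt2 C \<alpha> = src2 C \<beta>\<rbrakk> \<Longrightarrow> src2 C (\<beta> \<odot> \<alpha>) = src2 C \<alpha>"
    and tgt2_vcomp: "\<lbrakk>\<alpha> \<in> cells C; \<beta> \<in> cells C; tgt2 C \<alpha> = src2 C \<beta>\<rbrakk> \<Longrightarrow> tgt2 C (\<beta> \<odot> \<alpha>) = tgt2 C \<beta>"
    and vcomp_id2_right: "\<alpha> \<in> cells C \<Longrightarrow> \<alpha> \<odot> id2 C (src2 C \<alpha>) = \<alpha>"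
    and vcomp_id2_left: "\<alpha> \<in> cells C \<Longrightarrow> id2 C (tgt2 C \<alpha>) \<odot> \<alpha> = \<alpha>"
    and vcomp_assoc:
      "\<lbrakk>\<alpha> \<in> cells C; \<beta> \<in> cells C; \<gamma> \<in> cells C; tgt2 C \<alpha> = src2 C \<beta>; tgt2 C \<beta> = src2 C \<gamma>\<rbrakk>
        \<Longrightarrow> (\<gamma> \<odot> \<beta>) \<odot> \<alpha> = \<gamma> \<odot> (\<beta> \<odot> \<alpha>)"
    and hcomp_closed:
      "\<lbrakk>\<alpha> \<in> cells C; \<beta> \<in> cells C; tgt1 C (src2 C \<alpha>) = src1 C (src2 C \<beta>)\<rbrakk> \<Longrightarrow> \<alpha> \<star> \<beta> \<in> cells C"
    and src2_hcomp:
      "\<lbrakk>\<alpha> \<in> cells C; \<beta> \<in> cells C; tgt1 C (src2 C \<alpha>) = src1 C (src2 C \<beta>)\<rbrakk>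
        \<Longrightarrow> src2 C (\<alpha> \<star> \<beta>) = src2 C \<alpha> \<cdot> src2 C \<beta>"
    and tgt2_hcomp:
      "\<lbrakk>\<alpha> \<in> cells C; \<beta> \<in> cells C; tgt1 C (src2 C \<alpha>) = src1 C (src2 C \<beta>)\<rbrakk>
        \<Longrightarrow> tgt2 C (\<alpha> \<star> \<beta>) = tgt2 C \<alpha> \<cdot> tgt2 C \<beta>"
    and hcomp_id_left: "\<alpha> \<in> cells C \<Longrightarrow> id2 C (id1 C (src1 C (src2 C \<alpha>))) \<star> \<alpha> = \<alpha>"
    and hcomp_id_right: "\<alpha> \<in> cells C \<Longrightarrow> \<alpha> \<star> id2 C (id1 C (tgt1 C (src2 C \<alpha>))) = \<alpha>"
    and hcomp_assoc:
      "\<lbrakk>\<alpha> \<in> cells C; \<beta> \<in> cells C; \<gamma> \<in> cells C;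
        tgt1 C (src2 C \<alpha>) = src1 C (src2 C \<beta>); tgt1 C (src2 C \<beta>) = src1 C (src2 C \<gamma>)\<rbrakk>
        \<Longrightarrow> (\<alpha> \<star> \<beta>) \<star> \<gamma> = \<alpha> \<star> (\<beta> \<star> \<gamma>)"
    and hcomp_id2:
      "\<lbrakk>f \<in> arrs C; g \<in> arrs C; tgt1 C f = src1 C g\<rbrakk> \<Longrightarrow> id2 C f \<star> id2 C g = id2 C (f \<cdot> g)"
    and interchange:
      "\<lbrakk>\<alpha> \<in> cells C; \<beta> \<in> cells C; \<alpha>' \<in> cells C; \<beta>' \<in> cells C;
        tgt2 C \<alpha> = src2 C \<beta>; tgt2 C \<alpha>' = src2 C \<beta>'; tgt1 C (src2 C \<alpha>) = src1 C (src2 C \<alpha>')\<rbrakk>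
        \<Longrightarrow> (\<beta> \<odot> \<alpha>) \<star> (\<beta>' \<odot> \<alpha>') = (\<beta> \<star> \<beta>') \<odot> (\<alpha> \<star> \<alpha>')"

definition inverse_arrs :: "('o, 'a, 'c) two_category \<Rightarrow> 'a \<Rightarrow> 'a \<Rightarrow> bool" where
  "inverse_arrs C f g \<longleftrightarrow> f \<in> arrs C \<and> g \<in> arrs C \<and> src1 C g = tgt1 C f \<and> tgt1 C g = src1 C f \<and>
     f \<cdot>\<^bsub>C\<^esub> g = id1 C (src1 C f) \<and> g \<cdot>\<^bsub>C\<^esub> f = id1 C (tgt1 C f)"

definition inverse_cells :: "('o, 'a, 'c) two_category \<Rightarrow> 'c \<Rightarrow> 'c \<Rightarrow> bool" where
  "inverse_cells C \<alpha> \<beta> \<longleftrightarrow> \<alpha> \<in> cells C \<and> \<beta> \<in> cells C \<and> src2 C \<beta> = tgt2 C \<alpha> \<and> tgt2 C \<beta> = src2 C \<alpha> \<and>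
     \<beta> \<odot>\<^bsub>C\<^esub> \<alpha> = id2 C (src2 C \<alpha>) \<and> \<alpha> \<odot>\<^bsub>C\<^esub> \<beta> = id2 C (tgt2 C \<alpha>)"

definition vinverse :: "('o, 'a, 'c) two_category \<Rightarrow> 'c \<Rightarrow> 'c" where
  "vinverse C \<alpha> = (THE \<beta>. inverse_cells C \<alpha> \<beta>)"

locale strict_2_groupoid = strict_2_category +
  assumes arrs_invertible: "f \<in> arrs C \<Longrightarrow> \<exists>g. inverse_arrs C f g"
    and cells_invertible: "\<alpha> \<in> cells C \<Longrightarrow> \<exists>\<beta>. inverse_cells C \<alpha> \<beta>"

record ('o, 'a, 'c, 'p, 'b, 'd) two_functor =
  on_objs :: "'o \<Rightarrow> 'p"
  on_arrs :: "'a \<Rightarrow> 'b"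
  on_cells :: "'c \<Rightarrow> 'd"

locale strict_2_functor = source: strict_2_category D + target: strict_2_category C
  for D :: "('o, 'a, 'c) two_category"
    and C :: "('p, 'b, 'd) two_category"
    and F :: "('o, 'a, 'c, 'p, 'b, 'd) two_functor" +
  assumes on_objs_closed: "x \<in> objs D \<Longrightarrow> on_objs F x \<in> objs C"
    and on_arrs_closed: "f \<in> arrs D \<Longrightarrow> on_arrs F f \<in> arrs C"
    and on_cells_closed: "\<alpha> \<in> cells D \<Longrightarrow> on_cells F \<alpha> \<in> cells C"
    and map_src1: "f \<in> arrs D \<Longrightarrow> src1 C (on_arrs F f) = on_objs F (src1 D f)"
    and map_tgt1: "f \<in> arrs D \<Longrightarrow> tgt1 C (on_arrs F f) = on_objs F (tgt1 D f)"
    and map_src2: "\<alpha> \<in> cells D \<Longrightarrow> src2 C (on_cells F \<alpha>) = on_arrs F (src2 D \<alpha>)"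
    and map_tgt2: "\<alpha> \<in> cells D \<Longrightarrow> tgt2 C (on_cells F \<alpha>) = on_arrs F (tgt2 D \<alpha>)"
    and map_id1: "x \<in> objs D \<Longrightarrow> on_arrs F (id1 D x) = id1 C (on_objs F x)"
    and map_id2: "f \<in> arrs D \<Longrightarrow> on_cells F (id2 D f) = id2 C (on_arrs F f)"
    and map_comp1:
      "\<lbrakk>f \<in> arrs D; g \<in> arrs D; tgt1 D f = src1 D g\<rbrakk>
        \<Longrightarrow> on_arrs F (f \<cdot>\<^bsub>D\<^esub> g) = on_arrs F f \<cdot>\<^bsub>C\<^esub> on_arrs F g"
    and map_vcomp:
      "\<lbrakk>\<alpha> \<in> cells D; \<beta> \<in> cells D; tgt2 D \<alpha> = src2 D \<beta>\<rbrakk>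
        \<Longrightarrow> on_cells F (\<beta> \<odot>\<^bsub>D\<^esub> \<alpha>) = on_cells F \<beta> \<odot>\<^bsub>C\<^esub> on_cells F \<alpha>"
    and map_hcomp:
      "\<lbrakk>\<alpha> \<in> cells D; \<beta> \<in> cells D; tgt1 D (src2 D \<alpha>) = src1 D (src2 D \<beta>)\<rbrakk>
        \<Longrightarrow> on_cells F (\<alpha> \<star>\<^bsub>D\<^esub> \<beta>) = on_cells F \<alpha> \<star>\<^bsub>C\<^esub> on_cells F \<beta>"

definition End_monoid :: "('o, 'a, 'c) two_category \<Rightarrow> 'a \<Rightarrow> 'c monoid" where
  "End_monoid C h =
     \<lparr>carrier = {\<alpha> \<in> cells C. src2 C \<alpha> = h \<and> tgt2 C \<alpha> = h}, mult = vcomp C, one = id2 C h\<rparr>"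


section \<open>Two-dimensional Minkowski space\<close>

text \<open>An event is a pair \<open>(x, t)\<close>; the second component is time.\<close>

type_synonym event = "real \<times> real"

definition minkowski :: "event \<Rightarrow> event \<Rightarrow> real" where
  "minkowski v w = fst v * fst w - snd v * snd w"

definition timelike :: "event \<Rightarrow> bool" where
  "timelike v \<longleftrightarrow> minkowski v v < 0"

definition lightlike :: "event \<Rightarrow> bool" where
  "lightlike v \<longleftrightarrow> minkowski v v = 0 \<and> v \<noteq> 0"

definition spacelike :: "event \<Rightarrow> bool" where
  "spacelike v \<longleftrightarrow> minkowski v v > 0"

definition future :: "event \<Rightarrow> event set" where
  "future p = {q. minkowski (q - p) (q - p) \<le> 0 \<and> snd p \<le> snd q}"

definition past :: "event \<Rightarrow> event set" where
  "past p = {q. minkowski (q - p) (q - p) \<le> 0 \<and> snd q \<le> snd p}"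

definition causal_subset :: "event set \<Rightarrow> bool" where
  "causal_subset U \<longleftrightarrow> U \<noteq> {} \<and> (\<exists>p q. U = interior (future p \<inter> past q))"

definition left_corner :: "event set \<Rightarrow> event" where
  "left_corner U = (ARG_MIN fst p. p \<in> closure U)"

definition right_corner :: "event set \<Rightarrow> event" where
  "right_corner U = (ARG_MAX fst p. p \<in> closure U)"

definition bottom_vertex :: "event set \<Rightarrow> event" where
  "bottom_vertex U = (ARG_MIN snd p. p \<in> closure U)"

definition top_vertex :: "event set \<Rightarrow> event" where
  "top_vertex U = (ARG_MAX snd p. p \<in> closure U)"

definition spacelike_separated :: "event set \<Rightarrow> event set \<Rightarrow> bool" where
  "spacelike_separated U V \<longleftrightarrow> (\<forall>p\<in>U. \<forall>q\<in>V. spacelike (q - p))"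


section \<open>Cauchy surfaces\<close>

text \<open>
  Curves are continuously differentiable and parametrised by the whole real line, which is no
  restriction for curves defined on an open interval. A curve runs through the whole region iff
  it is inextendible there, i.e. has neither a past nor a future endpoint inside the region.
  The crossing condition below is imposed on curves that are timelike everywhere or lightlike
  everywhere. Any surface that is crossed exactly once by all curves with tangents of mixed
  type satisfies it as well.
\<close>

definition inextendible_curve :: "event set \<Rightarrow> (real \<Rightarrow> event) \<Rightarrow> bool" where
  "inextendible_curve U c \<longleftrightarrow> range c \<subseteq> U \<and>
     (\<forall>p\<in>U. \<not> (c \<longlongrightarrow> p) at_top \<and> \<not> (c \<longlongrightarrow> p) at_bot)"

definition timelike_curve :: "(real \<Rightarrow> event) \<Rightarrow> bool" where
  "timelike_curve c \<longleftrightarrow> (\<exists>c'. continuous_on UNIV c' \<and>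
     (\<forall>s. (c has_vector_derivative c' s) (at s) \<and> timelike (c' s)))"

definition lightlike_curve :: "(real \<Rightarrow> event) \<Rightarrow> bool" where
  "lightlike_curve c \<longleftrightarrow> (\<exists>c'. continuous_on UNIV c' \<and>
     (\<forall>s. (c has_vector_derivative c' s) (at s) \<and> lightlike (c' s)))"

text \<open>
  A subspace of the plane is automatically Hausdorff and second countable, so a one-dimensional
  (topological) manifold in it is a subset that is locally homeomorphic to the real line.
\<close>

definition one_manifold :: "event set \<Rightarrow> bool" where
  "one_manifold S \<longleftrightarrow>
     (\<forall>p\<in>S. \<exists>V. openin (top_of_set S) V \<and> p \<in> V \<and> V homeomorphic (UNIV :: real set))"

definition cauchy_surface :: "event set \<Rightarrow> event set \<Rightarrow> bool" where
  "cauchy_surface U S \<longleftrightarrow> S \<subseteq> U \<and> one_manifold S \<and>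
     (\<forall>c. inextendible_curve U c \<and> (timelike_curve c \<or> lightlike_curve c) \<longrightarrow> (\<exists>!s. c s \<in> S))"


section \<open>Nets of monoids\<close>

text \<open>
  \<open>algebra A U\<close> is the monoid attached to \<open>U\<close>, and \<open>incl A U' U\<close> is the map attached to the
  inclusion \<open>U' \<subseteq> U\<close>.
\<close>

record 'm net =
  algebra :: "event set \<Rightarrow> 'm monoid"
  incl :: "event set \<Rightarrow> event set \<Rightarrow> 'm \<Rightarrow> 'm"

locale functor_to_monoids =
  fixes A :: "'m net"
  assumes algebra_monoid: "causal_subset U \<Longrightarrow> monoid (algebra A U)"
    and incl_hom:
      "\<lbrakk>causal_subset U'; causal_subset U; U' \<subseteq> U\<rbrakk>
        \<Longrightarrow> incl A U' U \<in> hom (algebra A U') (algebra A U)"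
    and incl_one:
      "\<lbrakk>causal_subset U'; causal_subset U; U' \<subseteq> U\<rbrakk>
        \<Longrightarrow> incl A U' U \<one>\<^bsub>algebra A U'\<^esub> = \<one>\<^bsub>algebra A U\<^esub>"
    and incl_id:
      "\<lbrakk>causal_subset U; a \<in> carrier (algebra A U)\<rbrakk> \<Longrightarrow> incl A U U a = a"
    and incl_comp:
      "\<lbrakk>causal_subset U''; causal_subset U'; causal_subset U; U'' \<subseteq> U'; U' \<subseteq> U;
        a \<in> carrier (algebra A U'')\<rbrakk>
        \<Longrightarrow> incl A U' U (incl A U'' U' a) = incl A U'' U a"

locale net_of_monoids = functor_to_monoids +
  assumes incl_inj:
    "\<lbrakk>causal_subset U'; causal_subset U; U' \<subseteq> U\<rbrakk>
      \<Longrightarrow> inj_on (incl A U' U) (carrier (algebra A U'))"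

locale net_of_local_monoids = net_of_monoids +
  assumes locality:
    "\<lbrakk>causal_subset U1; causal_subset U2; causal_subset U; U1 \<subseteq> U; U2 \<subseteq> U;
      spacelike_separated U1 U2; a \<in> carrier (algebra A U1); b \<in> carrier (algebra A U2)\<rbrakk>
      \<Longrightarrow> incl A U1 U a \<otimes>\<^bsub>algebra A U\<^esub> incl A U2 U b
        = incl A U2 U b \<otimes>\<^bsub>algebra A U\<^esub> incl A U1 U a"

definition time_slice_axiom :: "'m net \<Rightarrow> bool" where
  "time_slice_axiom A \<longleftrightarrow>
     (\<forall>U S \<U>. causal_subset U \<and> cauchy_surface U S \<and>
        (\<forall>U'\<in>\<U>. causal_subset U' \<and> U' \<subseteq> U) \<and> S \<subseteq> \<Union>\<U> \<longrightarrow>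
        (\<Union>U'\<in>\<U>. incl A U' U ` carrier (algebra A U')) = carrier (algebra A U))"


section \<open>The 2-category of lightlike paths\<close>

text \<open>
  A right-moving path is the graph of a function over an interval of the \<open>x\<close>-axis, so up to
  reparametrisation it is determined by the set of its points. It is represented by the triple of
  its left end, that set, and its right end. Concatenation is then strictly associative and unital.
\<close>

type_synonym path = "event \<times> event set \<times> event"

definition path_start :: "path \<Rightarrow> event" where "path_start \<gamma> = fst \<gamma>"
definition path_points :: "path \<Rightarrow> event set" where "path_points \<gamma> = fst (snd \<gamma>)"
definition path_end :: "path \<Rightarrow> event" where "path_end \<gamma> = snd (snd \<gamma>)"

definition path_concat :: "path \<Rightarrow> path \<Rightarrow> path" where
  "path_concat \<gamma> \<delta> = (path_start \<gamma>, path_points \<gamma> \<union> path_points \<delta>, path_end \<delta>)"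

fun polygonal_path :: "event list \<Rightarrow> path" where
  "polygonal_path [p] = (p, {p}, p)"
| "polygonal_path (p # q # ps) = path_concat (p, closed_segment p q, q) (polygonal_path (q # ps))"

definition up_right :: "event \<Rightarrow> event \<Rightarrow> bool" where
  "up_right p q \<longleftrightarrow> (\<exists>s\<ge>0. q = p + s *\<^sub>R (1, 1))"

definition down_right :: "event \<Rightarrow> event \<Rightarrow> bool" where
  "down_right p q \<longleftrightarrow> (\<exists>s\<ge>0. q = p + s *\<^sub>R (1, -1))"

definition lightlike_paths :: "path set" where
  "lightlike_paths =
     {polygonal_path ps | ps. ps \<noteq> [] \<and> successively (\<lambda>p q. up_right p q \<or> down_right p q) ps}"

definition future_boundary :: "event set \<Rightarrow> path" where
  "future_boundary U = polygonal_path [left_corner U, top_vertex U, right_corner U]"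

definition past_boundary :: "event set \<Rightarrow> path" where
  "past_boundary U = polygonal_path [left_corner U, bottom_vertex U, right_corner U]"

text \<open>
  A 2-morphism is a triple of its source path (the future boundary), the region it fills, and its
  target path (the past boundary). Regions that share only a piece of an edge are glued by first
  gluing degenerate regions to their ends (whiskering) and then gluing along a full path.
\<close>

type_synonym path_region = "path \<times> event set \<times> path"

inductive_set glued_regions :: "path_region set" where
  degenerate: "\<gamma> \<in> lightlike_paths \<Longrightarrow> (\<gamma>, path_points \<gamma>, \<gamma>) \<in> glued_regions"
| causal: "causal_subset U \<Longrightarrow> (future_boundary U, closure U, past_boundary U) \<in> glued_regions"
| vertical: "\<lbrakk>(\<gamma>, R, \<delta>) \<in> glued_regions; (\<delta>, S, \<epsilon>) \<in> glued_regions\<rbrakk>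
    \<Longrightarrow> (\<gamma>, R \<union> S, \<epsilon>) \<in> glued_regions"
| horizontal: "\<lbrakk>(\<gamma>, R, \<delta>) \<in> glued_regions; (\<gamma>', S, \<delta>') \<in> glued_regions; path_end \<gamma> = path_start \<gamma>'\<rbrakk>
    \<Longrightarrow> (path_concat \<gamma> \<gamma>', R \<union> S, path_concat \<delta> \<delta>') \<in> glued_regions"

definition P2 :: "(event, path, path_region) two_category" where
  "P2 = \<lparr>objs = UNIV, arrs = lightlike_paths, cells = glued_regions,
     src1 = path_start, tgt1 = path_end,
     src2 = fst, tgt2 = (\<lambda>\<alpha>. snd (snd \<alpha>)),
     id1 = (\<lambda>p. (p, {p}, p)), id2 = (\<lambda>\<gamma>. (\<gamma>, path_points \<gamma>, \<gamma>)),
     comp1 = path_concat,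
     vcomp = (\<lambda>\<beta> \<alpha>. (fst \<alpha>, fst (snd \<alpha>) \<union> fst (snd \<beta>), snd (snd \<beta>))),
     hcomp = (\<lambda>\<alpha> \<beta>. (path_concat (fst \<alpha>) (fst \<beta>), fst (snd \<alpha>) \<union> fst (snd \<beta>),
                      path_concat (snd (snd \<alpha>)) (snd (snd \<beta>))))\<rparr>"

lemma causal_diamond_iff:
  "q \<in> future p1 \<inter> past p2 \<longleftrightarrow>
     fst p1 + snd p1 \<le> fst q + snd q \<and> fst q + snd q \<le> fst p2 + snd p2 \<and>
     fst p2 - snd p2 \<le> fst q - snd q \<and> fst q - snd q \<le> fst p1 - snd p1"
proof -
  have *: "x * x - t * t \<le> 0 \<longleftrightarrow> \<bar>x\<bar> \<le> \<bar>t\<bar>" for x t :: real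
    using abs_le_square_iff[of x t] by (simp add: power2_eq_square)
  show ?thesis
    unfolding future_def past_def minkowski_def Int_iff mem_Collect_eq fst_diff snd_diff *
    by auto
qed

lemma causal_subset_rectangle:
  assumes "causal_subset U"
  obtains a a' b b' where "a < a'" "b < b'"
    "U = {q. a < fst q + snd q \<and> fst q + snd q < a' \<and> b < fst q - snd q \<and> fst q - snd q < b'}"
    "closure U = {q. a \<le> fst q + snd q \<and> fst q + snd q \<le> a' \<and> b \<le> fst q - snd q \<and> fst q - snd q \<le> b'}"
    "convex (closure U)"
proof -
  obtain p1 p2 where U: "U \<noteq> {}" "U = interior (future p1 \<inter> past p2)"
    using assms unfolding causal_subset_def by blast
  define a a' b b' where "a = fst p1 + snd p1" and "a' = fst p2 + snd p2"
    and "b = fst p2 - snd p2" and "b' = fst p1 - snd p1"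
  let ?H = "\<lambda>v c. {q::event. v \<bullet> q \<le> c}"
  let ?I = "\<lambda>v c. {q::event. v \<bullet> q < c}"
  have F: "future p1 \<inter> past p2 = ?H (-1,-1) (-a) \<inter> ?H (1,1) a' \<inter> ?H (-1,1) (-b) \<inter> ?H (1,-1) b'"
  proof (rule Set.set_eqI)
    fix q
    have "q \<in> future p1 \<inter> past p2 \<longleftrightarrow> a \<le> fst q + snd q \<and> fst q + snd q \<le> a' \<and>
        b \<le> fst q - snd q \<and> fst q - snd q \<le> b'"
      unfolding causal_diamond_iff a_def a'_def b_def b'_def ..
    also have "\<dots> \<longleftrightarrow> q \<in> ?H (-1,-1) (-a) \<inter> ?H (1,1) a' \<inter> ?H (-1,1) (-b) \<inter> ?H (1,-1) b'"
      by (cases q) auto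
    finally show "q \<in> future p1 \<inter> past p2 \<longleftrightarrow>
        q \<in> ?H (-1,-1) (-a) \<inter> ?H (1,1) a' \<inter> ?H (-1,1) (-b) \<inter> ?H (1,-1) b'" .
  qed
  have int: "interior (?H v c) = ?I v c" if "v \<noteq> (0, 0)" for v c
    using that by (intro interior_halfspace_le) (simp add: zero_prod_def)
  have "U = ?I (-1,-1) (-a) \<inter> ?I (1,1) a' \<inter> ?I (-1,1) (-b) \<inter> ?I (1,-1) b'"
    unfolding U(2) F interior_Int by (simp add: int)
  also have "\<dots> = {q. a < fst q + snd q \<and> fst q + snd q < a' \<and> b < fst q - snd q \<and> fst q - snd q < b'}"
    by (rule Set.set_eqI, case_tac x) auto
  finally have U': "U = {q. a < fst q + snd q \<and> fst q + snd q < a' \<and> b < fst q - snd q \<and> fst q - snd q < b'}" .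
  have cv: "convex (future p1 \<inter> past p2)"
    unfolding F by (intro convex_Int convex_halfspace_le)
  have "closed (future p1 \<inter> past p2)"
    unfolding F by (intro closed_Int closed_halfspace_le)
  then have cl: "closure U = future p1 \<inter> past p2"
    using convex_closure_interior[OF cv] U closure_closed by simp
  have c: "closure U = {q. a \<le> fst q + snd q \<and> fst q + snd q \<le> a' \<and> b \<le> fst q - snd q \<and> fst q - snd q \<le> b'}"
    unfolding cl Set.set_eq_iff causal_diamond_iff a_def a'_def b_def b'_def by simp
  obtain q where "q \<in> U" using U(1) by blast
  then have "a < a'" "b < b'"
    unfolding U' by auto
  then show thesis using that U' c cv cl by simp
qed

lemma corners_rectangle:
  assumes "a < a'" "b < b'"
    and c: "closure U = {q. a \<le> fst q + snd q \<and> fst q + snd q \<le> a' \<and> b \<le> fst q - snd q \<and> fst q - snd q \<le> b'}"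
  shows "left_corner U = ((a + b) / 2, (a - b) / 2)"
    and "right_corner U = ((a' + b') / 2, (a' - b') / 2)"
    and "bottom_vertex U = ((a + b') / 2, (a - b') / 2)"
    and "top_vertex U = ((a' + b) / 2, (a' - b) / 2)"
proof -
  have l: "is_arg_min fst (\<lambda>p. p \<in> closure U) q \<longleftrightarrow> q = ((a + b) / 2, (a - b) / 2)" (is "_ \<longleftrightarrow> q = ?l") for q
  proof
    assume "is_arg_min fst (\<lambda>p. p \<in> closure U) q"
    moreover have "?l \<in> closure U" using assms by (simp add: c field_simps)
    ultimately have "q \<in> closure U" "fst q \<le> (a + b) / 2"
      unfolding is_arg_min_linorder by fastforce+
    then show "q = ?l" unfolding c by (intro prod_eqI) auto
  qed (use assms in \<open>auto simp: c is_arg_min_linorder field_simps\<close>)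
  show "left_corner U = ?l" unfolding left_corner_def arg_min_def l by simp
  have r: "is_arg_max fst (\<lambda>p. p \<in> closure U) q \<longleftrightarrow> q = ((a' + b') / 2, (a' - b') / 2)" (is "_ \<longleftrightarrow> q = ?r") for q
  proof
    assume "is_arg_max fst (\<lambda>p. p \<in> closure U) q"
    moreover have "?r \<in> closure U" using assms by (simp add: c field_simps)
    ultimately have "q \<in> closure U" "fst q \<ge> (a' + b') / 2"
      unfolding is_arg_max_linorder by fastforce+
    then show "q = ?r" unfolding c by (intro prod_eqI) auto
  qed (use assms in \<open>auto simp: c is_arg_max_linorder field_simps\<close>)
  show "right_corner U = ?r" unfolding right_corner_def arg_max_def r by simp
  have m: "is_arg_min snd (\<lambda>p. p \<in> closure U) q \<longleftrightarrow> q = ((a + b') / 2, (a - b') / 2)" (is "_ \<longleftrightarrow> q = ?m") for q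
  proof
    assume "is_arg_min snd (\<lambda>p. p \<in> closure U) q"
    moreover have "?m \<in> closure U" using assms by (simp add: c field_simps)
    ultimately have "q \<in> closure U" "snd q \<le> (a - b') / 2"
      unfolding is_arg_min_linorder by fastforce+
    then show "q = ?m" unfolding c by (intro prod_eqI) auto
  qed (use assms in \<open>auto simp: c is_arg_min_linorder field_simps\<close>)
  show "bottom_vertex U = ?m" unfolding bottom_vertex_def arg_min_def m by simp
  have n: "is_arg_max snd (\<lambda>p. p \<in> closure U) q \<longleftrightarrow> q = ((a' + b) / 2, (a' - b) / 2)" (is "_ \<longleftrightarrow> q = ?n") for q
  proof
    assume "is_arg_max snd (\<lambda>p. p \<in> closure U) q"
    moreover have "?n \<in> closure U" using assms by (simp add: c field_simps)
    ultimately have "q \<in> closure U" "snd q \<ge> (a' - b) / 2"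
      unfolding is_arg_max_linorder by fastforce+
    then show "q = ?n" unfolding c by (intro prod_eqI) auto
  qed (use assms in \<open>auto simp: c is_arg_max_linorder field_simps\<close>)
  show "top_vertex U = ?n" unfolding top_vertex_def arg_max_def n by simp
qed

lemma polygonal_path_start_end:
  "ps \<noteq> [] \<Longrightarrow> path_start (polygonal_path ps) = hd ps \<and> path_end (polygonal_path ps) = last ps
     \<and> set ps \<subseteq> path_points (polygonal_path ps)"
  by (induction ps rule: polygonal_path.induct)
     (auto simp: path_concat_def path_start_def path_end_def path_points_def)

lemma path_concat_assoc: "path_concat (path_concat f g) h = path_concat f (path_concat g h)"
  by (auto simp: path_concat_def path_start_def path_end_def path_points_def)

lemma polygonal_path_append:
  "ps \<noteq> [] \<Longrightarrow> qs \<noteq> [] \<Longrightarrow> last ps = hd qs \<Longrightarrow>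
     polygonal_path (ps @ tl qs) = path_concat (polygonal_path ps) (polygonal_path qs)"
proof (induction ps rule: polygonal_path.induct)
  case (1 p)
  have "p # tl qs = qs" using 1 by (cases qs) simp_all
  moreover have "p = path_start (polygonal_path qs)" "p \<in> path_points (polygonal_path qs)"
    using 1 polygonal_path_start_end[of qs] hd_in_set[of qs] by auto
  ultimately show ?case
    by (simp add: path_concat_def path_start_def path_end_def path_points_def insert_absorb)
next
  case (2 p q ps)
  then show ?case by (simp add: path_concat_assoc)
next
  case 3
  then show ?case by simp
qed

lemma lightlike_pathsI:
  "\<lbrakk>ps \<noteq> []; successively (\<lambda>p q. up_right p q \<or> down_right p q) ps\<rbrakk>
     \<Longrightarrow> polygonal_path ps \<in> lightlike_paths"
  unfolding lightlike_paths_def by blast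

lemma lightlike_paths_concat:
  assumes "f \<in> lightlike_paths" "g \<in> lightlike_paths" "path_end f = path_start g"
  shows "path_concat f g \<in> lightlike_paths"
proof -
  let ?P = "\<lambda>p q. up_right p q \<or> down_right p q"
  obtain ps qs where f: "f = polygonal_path ps" "ps \<noteq> []" "successively ?P ps"
    and g: "g = polygonal_path qs" "qs \<noteq> []" "successively ?P qs"
    using assms unfolding lightlike_paths_def by blast
  have e: "last ps = hd qs"
    using assms(3) polygonal_path_start_end f g by metis
  have "successively ?P (ps @ tl qs)"
    using f(2,3) g(2,3) e
    by (cases qs) (auto simp: successively_append_iff successively_Cons)
  then show ?thesis
    using polygonal_path_append[OF f(2) g(2) e, symmetric] f(2) unfolding lightlike_paths_def f(1) g(1)
    by (intro CollectI exI[of _ "ps @ tl qs"]) simp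
qed

lemma lightlike_paths_points:
  assumes "f \<in> lightlike_paths"
  shows "path_start f \<in> path_points f" "path_end f \<in> path_points f"
proof -
  obtain ps where "f = polygonal_path ps" "ps \<noteq> []"
    using assms unfolding lightlike_paths_def by blast
  then show "path_start f \<in> path_points f" "path_end f \<in> path_points f"
    using polygonal_path_start_end[of ps] hd_in_set[of ps] last_in_set[of ps] by auto
qed

lemma path_concat_start_end [simp]:
  "path_start (path_concat f g) = path_start f" "path_end (path_concat f g) = path_end g"
  "path_points (path_concat f g) = path_points f \<union> path_points g"
  by (simp_all add: path_concat_def path_start_def path_end_def path_points_def)

lemma glued_regions_paths:
  "(f, R, g) \<in> glued_regions \<Longrightarrow> f \<in> lightlike_paths \<and> g \<in> lightlike_paths \<and>
     path_start f = path_start g \<and> path_end f = path_end g \<and> path_points f \<subseteq> R \<and> path_points g \<subseteq> R"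
proof (induction f R g rule: glued_regions.induct)
  case (causal U)
  then obtain a a' b b' where ab: "a < a'" "b < b'"
    and c: "closure U = {q. a \<le> fst q + snd q \<and> fst q + snd q \<le> a' \<and> b \<le> fst q - snd q \<and> fst q - snd q \<le> b'}"
    and convex: "convex (closure U)"
    by (rule causal_subset_rectangle)
  note k = corners_rectangle[OF ab c]
  have up: "up_right (left_corner U) (top_vertex U)" "up_right (bottom_vertex U) (right_corner U)"
    unfolding k up_right_def using ab
    by (auto intro!: exI[of _ "(a' - a) / 2"] simp: field_simps)
  have down: "down_right (left_corner U) (bottom_vertex U)" "down_right (top_vertex U) (right_corner U)"
    unfolding k down_right_def using ab
    by (auto intro!: exI[of _ "(b' - b) / 2"] simp: field_simps)
  have paths: "future_boundary U \<in> lightlike_paths" "past_boundary U \<in> lightlike_paths"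
    unfolding future_boundary_def past_boundary_def
    by (rule lightlike_pathsI, use up down in simp, use up down in simp)+
  have "{left_corner U, right_corner U, bottom_vertex U, top_vertex U} \<subseteq> closure U"
    unfolding k c using ab by (auto simp: field_simps)
  then have "path_points (future_boundary U) \<subseteq> closure U" "path_points (past_boundary U) \<subseteq> closure U"
    using convex unfolding future_boundary_def past_boundary_def
    by (simp_all add: path_concat_def path_points_def closed_segment_subset)
  moreover have "path_start (future_boundary U) = path_start (past_boundary U)"
    "path_end (future_boundary U) = path_end (past_boundary U)"
    by (simp_all add: future_boundary_def past_boundary_def polygonal_path_start_end del: polygonal_path.simps)
  ultimately show ?case using paths by blast
next
  case (horizontal \<gamma> R \<delta> \<gamma>' S \<delta>')
  then have "path_end \<delta> = path_start \<delta>'" by simp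
  with horizontal show ?case
    using lightlike_paths_concat[of \<gamma> \<gamma>'] lightlike_paths_concat[of \<delta> \<delta>']
    by (simp add: le_supI1 le_supI2)
next
  case (degenerate \<gamma>)
  then show ?case by simp
next
  case (vertical \<gamma> R \<delta> S \<epsilon>)
  then show ?case by (simp add: le_supI1 le_supI2)
qed

lemma P2_strict_2_category: "strict_2_category P2"
proof -
  have point: "(p, {p}, p) \<in> lightlike_paths" for p
    unfolding lightlike_paths_def by (auto intro!: exI[of _ "[p]"])
  have unit: "path_concat (path_start f, {path_start f}, path_start f) f = f"
      "path_concat f (path_end f, {path_end f}, path_end f) = f" if "f \<in> lightlike_paths" for f
    using lightlike_paths_points[OF that]
    by (auto simp: path_concat_def path_start_def path_end_def path_points_def prod_eq_iff)
  have glued: "fst \<alpha> \<in> lightlike_paths" "snd (snd \<alpha>) \<in> lightlike_paths"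
      "path_start (fst \<alpha>) = path_start (snd (snd \<alpha>))" "path_end (fst \<alpha>) = path_end (snd (snd \<alpha>))"
      "path_points (fst \<alpha>) \<subseteq> fst (snd \<alpha>)" "path_points (snd (snd \<alpha>)) \<subseteq> fst (snd \<alpha>)"
    if "\<alpha> \<in> glued_regions" for \<alpha>
    using that glued_regions_paths by (cases \<alpha>; fastforce)+
  have ends: "path_start (fst \<alpha>) \<in> fst (snd \<alpha>)" "path_end (fst \<alpha>) \<in> fst (snd \<alpha>)"
    if "\<alpha> \<in> glued_regions" for \<alpha>
    using glued[OF that] lightlike_paths_points by blast+
  have v: "(fst \<alpha>, fst (snd \<alpha>) \<union> fst (snd \<beta>), snd (snd \<beta>)) \<in> glued_regions"
    if "\<alpha> \<in> glued_regions" "\<beta> \<in> glued_regions" "snd (snd \<alpha>) = fst \<beta>" for \<alpha> \<beta>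
    using that by (cases \<alpha>; cases \<beta>) (auto intro: glued_regions.vertical)
  have h: "(path_concat (fst \<alpha>) (fst \<beta>), fst (snd \<alpha>) \<union> fst (snd \<beta>),
        path_concat (snd (snd \<alpha>)) (snd (snd \<beta>))) \<in> glued_regions"
    if "\<alpha> \<in> glued_regions" "\<beta> \<in> glued_regions" "path_end (fst \<alpha>) = path_start (fst \<beta>)" for \<alpha> \<beta>
    using that by (cases \<alpha>; cases \<beta>) (auto intro: glued_regions.horizontal)
  have pt: "path_points (p, {p}, p) = {p}" "path_start (p, {p}, p) = p" "path_end (p, {p}, p) = p" for p
    by (simp_all add: path_points_def path_start_def path_end_def)
  have unit': "path_concat (path_start (snd (snd \<alpha>)), {path_start (snd (snd \<alpha>))}, path_start (snd (snd \<alpha>))) (fst \<alpha>) = fst \<alpha>"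
      "path_concat (fst \<alpha>) (path_end (snd (snd \<alpha>)), {path_end (snd (snd \<alpha>))}, path_end (snd (snd \<alpha>))) = fst \<alpha>"
      "insert (path_start (snd (snd \<alpha>))) (fst (snd \<alpha>)) = fst (snd \<alpha>)"
      "insert (path_end (snd (snd \<alpha>))) (fst (snd \<alpha>)) = fst (snd \<alpha>)"
    if "\<alpha> \<in> glued_regions" for \<alpha>
    using unit[of "fst \<alpha>"] ends[OF that] glued[OF that] by (auto simp: insert_absorb)
  show ?thesis
    by (unfold_locales; simp only: P2_def two_category.simps simp_thms UNIV_I)
       (simp_all add: glued unit unit' point lightlike_paths_concat path_concat_assoc v h pt
          glued_regions.degenerate prod_eq_iff Un_assoc Un_left_commute insert_absorb ends
          Un_absorb1 Un_absorb2 del: split_paired_All)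
qed

definition region_between :: "path \<Rightarrow> path \<Rightarrow> event set" where
  "region_between \<gamma> \<delta> =
     {(x, t). \<exists>t1 t2. (x, t1) \<in> path_points \<gamma> \<and> (x, t2) \<in> path_points \<delta> \<and> t2 \<le> t \<and> t \<le> t1}"


section \<open>The net of an extended field theory\<close>

definition whisker :: "('o, 'a, 'c) two_category \<Rightarrow> 'a \<Rightarrow> 'c \<Rightarrow> 'a \<Rightarrow> 'c" where
  "whisker C g \<alpha> h = id2 C g \<star>\<^bsub>C\<^esub> \<alpha> \<star>\<^bsub>C\<^esub> id2 C h"

definition AZ_incl ::
  "('o, 'a, 'c) two_category \<Rightarrow> (event, path, path_region, 'o, 'a, 'c) two_functor
    \<Rightarrow> event set \<Rightarrow> event set \<Rightarrow> 'c \<Rightarrow> 'c" where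
  "AZ_incl C Z U' U a =
     (let p = left_corner U; m = bottom_vertex U; q = right_corner U;
          p' = left_corner U'; m' = bottom_vertex U'; q' = right_corner U';
          u = (THE u. u \<in> closed_segment p m \<and> up_right u p');
          v = (THE v. v \<in> closed_segment m q \<and> down_right q' v);
          \<gamma> = polygonal_path [u, p', m', q', v];
          \<delta> = polygonal_path [u, m, v];
          f = (\<gamma>, region_between \<gamma> \<delta>, \<delta>);
          f' = whisker P2 (polygonal_path [p, u]) f (polygonal_path [v, q]);
          a' = whisker C (on_arrs Z (polygonal_path [p, u, p'])) a (on_arrs Z (polygonal_path [q', v, q]))
      in on_cells Z f' \<odot>\<^bsub>C\<^esub> a' \<odot>\<^bsub>C\<^esub> vinverse C (on_cells Z f'))"

definition AZ ::
  "('o, 'a, 'c) two_category \<Rightarrow> (event, path, path_region, 'o, 'a, 'c) two_functor \<Rightarrow> 'c net" where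
  "AZ C Z = \<lparr>algebra = (\<lambda>U. End_monoid C (on_arrs Z (past_boundary U))), incl = AZ_incl C Z\<rparr>"

end

theory Submission
  imports Defs
begin

text \<open>
  Let \<open>\<xi> = x + t\<close> and \<open>\<eta> = x - t\<close> be the null coordinates. A right-moving lightlike path is a monotone
  staircase in the \<open>(\<xi>, \<eta>)\<close>-plane. Among the staircases from \<open>p\<close> to \<open>q\<close> the lowest one increases \<open>\<eta>\<close>
  first and \<open>\<xi>\<close> afterwards. The past boundary of a causal subset is the lowest path from its left to
  its right corner.

  Everything rests on one fact about \<^const>\<open>P2\<close>: in the category of paths from \<open>p\<close> to \<open>q\<close> and regions
  between them there is at most one morphism between two objects, and the lowest path is terminal.
  For uniqueness (\<open>P2_hom2_unique\<close>): a lightlike path is the graph of a function of \<open>x\<close>, and every glued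
  region is the set of points between its two boundary graphs. For existence (\<open>descent_hom2\<close>): an
  up-down corner of a staircase is pushed down to a down-up corner across one rectangle, and finitely
  many such moves lead to the lowest path.

  Let \<open>\<sigma>\<close> lead from \<open>p\<close> to \<open>p'\<close> and \<open>\<rho>\<close> from \<open>q'\<close> to \<open>q\<close>. Whiskering an endomorphism of the lowest path
  from \<open>p'\<close> to \<open>q'\<close> by \<open>\<sigma>\<close> and \<open>\<rho>\<close>, and conjugating by the descent of the resulting detour, yields an
  endomorphism of the lowest path from \<open>p\<close> to \<open>q\<close>. This \<open>transport\<close> is the map that the net attaches to
  an inclusion when \<open>\<sigma>\<close> and \<open>\<rho>\<close> are lowest paths. Uniqueness of regions and the interchange law imply
  that it does not depend on \<open>\<sigma>\<close> and \<open>\<rho>\<close> (\<open>transport_independent\<close>) and that transports compose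
  (\<open>transport_transport\<close>); together these give functoriality.

  Two spacelike separated causal subsets lie side by side: a right-moving path leads from the right
  corner of one of them to the left corner of the other, so a single staircase runs through both past
  boundaries. Transporting along it whiskers the two observables at disjoint places of one path, where
  they commute by interchange.

  Because 1-morphisms and 2-morphisms are invertible, whiskering and conjugation are bijective, and so
  is every inclusion map. This yields injectivity, and it reduces the time slice axiom to the statement
  that a cover of a Cauchy surface has at least one member. It has one because a Cauchy surface meets
  the timelike curve that runs from the bottom to the top vertex.
\<close>

section \<open>Null coordinates and lowest paths\<close>

text \<open>The relation says exactly that there is a right-moving lightlike path from \<open>p\<close> to \<open>q\<close>.\<close>
definition weakly_right :: "event \<Rightarrow> event \<Rightarrow> bool" where
  "weakly_right p q \<longleftrightarrow> fst p + snd p \<le> fst q + snd q \<and> fst p - snd p \<le> fst q - snd q"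

text \<open>The event with the null coordinate \<open>\<xi>\<close> of \<open>p\<close> and the null coordinate \<open>\<eta>\<close> of \<open>q\<close>.\<close>
definition low_corner :: "event \<Rightarrow> event \<Rightarrow> event" where
  "low_corner p q =
     ((fst p + snd p + (fst q - snd q)) / 2, (fst p + snd p - (fst q - snd q)) / 2)"

definition low_path :: "event \<Rightarrow> event \<Rightarrow> path" where
  "low_path p q = polygonal_path [p, low_corner p q, q]"

lemma low_corner_null_coordinates [simp]:
  "fst (low_corner p q) + snd (low_corner p q) = fst p + snd p"
  "fst (low_corner p q) - snd (low_corner p q) = fst q - snd q"
  by (simp_all add: low_corner_def field_simps)

lemma null_coordinates_eqI:
  fixes p q :: event
  assumes "fst p + snd p = fst q + snd q" "fst p - snd p = fst q - snd q"
  shows "p = q"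
  using assms by (intro prod_eqI) linarith+

lemma up_right_iff:
  "up_right p q \<longleftrightarrow> fst p + snd p \<le> fst q + snd q \<and> fst p - snd p = fst q - snd q"
proof
  assume "fst p + snd p \<le> fst q + snd q \<and> fst p - snd p = fst q - snd q"
  then show "up_right p q"
    unfolding up_right_def by (intro exI[of _ "fst q - fst p"]) (auto simp: prod_eq_iff)
qed (auto simp: up_right_def)

lemma down_right_iff:
  "down_right p q \<longleftrightarrow> fst p + snd p = fst q + snd q \<and> fst p - snd p \<le> fst q - snd q"
proof
  assume "fst p + snd p = fst q + snd q \<and> fst p - snd p \<le> fst q - snd q"
  then show "down_right p q"
    unfolding down_right_def by (intro exI[of _ "fst q - fst p"]) (auto simp: prod_eq_iff)
qed (auto simp: down_right_def)

lemma on_parallel_segment_iff: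
  fixes z p d :: "'a::real_vector"
  assumes "0 \<le> s"
  shows "z \<in> closed_segment p (p + s *\<^sub>R d) \<longleftrightarrow> (\<exists>r. 0 \<le> r \<and> r \<le> s \<and> z = p + r *\<^sub>R d)"
proof
  assume "z \<in> closed_segment p (p + s *\<^sub>R d)"
  then obtain k where k: "0 \<le> k" "k \<le> 1" "z = (1 - k) *\<^sub>R p + k *\<^sub>R (p + s *\<^sub>R d)"
    unfolding closed_segment_def by blast
  then have "z = p + (k * s) *\<^sub>R d" by (simp add: algebra_simps)
  then show "\<exists>r. 0 \<le> r \<and> r \<le> s \<and> z = p + r *\<^sub>R d"
    using k assms by (intro exI[of _ "k * s"]) (simp add: mult_left_le_one_le)
next
  assume "\<exists>r. 0 \<le> r \<and> r \<le> s \<and> z = p + r *\<^sub>R d"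
  then obtain r where r: "0 \<le> r" "r \<le> s" "z = p + r *\<^sub>R d" by blast
  show "z \<in> closed_segment p (p + s *\<^sub>R d)"
  proof (cases "s = 0")
    case False
    then show ?thesis
      using r assms unfolding closed_segment_def
      by (intro CollectI exI[of _ "r / s"]) (simp add: algebra_simps)
  qed (use r in simp)
qed

lemma closed_segment_up_right:
  assumes "up_right p q"
  shows "z \<in> closed_segment p q \<longleftrightarrow> up_right p z \<and> up_right z q"
proof -
  obtain s where s: "0 \<le> s" "q = p + s *\<^sub>R (1, 1)" using assms up_right_def by auto
  show ?thesis
    unfolding s(2) on_parallel_segment_iff[OF s(1)] up_right_iff
    by (auto intro!: exI[of _ "fst z - fst p"] simp: prod_eq_iff)
qed

lemma closed_segment_down_right:
  assumes "down_right p q"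
  shows "z \<in> closed_segment p q \<longleftrightarrow> down_right p z \<and> down_right z q"
proof -
  obtain s where s: "0 \<le> s" "q = p + s *\<^sub>R (1, -1)" using assms down_right_def by auto
  show ?thesis
    unfolding s(2) on_parallel_segment_iff[OF s(1)] down_right_iff
    by (auto intro!: exI[of _ "fst z - fst p"] simp: prod_eq_iff)
qed

lemma weakly_right_refl [simp]: "weakly_right p p"
  by (simp add: weakly_right_def)

lemma weakly_right_trans: "weakly_right p q \<Longrightarrow> weakly_right q r \<Longrightarrow> weakly_right p r"
  by (auto simp: weakly_right_def)

lemma low_corner_lightlike:
  assumes "weakly_right p q"
  shows "down_right p (low_corner p q)" "up_right (low_corner p q) q"
  using assms by (auto simp: weakly_right_def down_right_iff up_right_iff)

lemma low_path_lightlike [simp]: "weakly_right p q \<Longrightarrow> low_path p q \<in> lightlike_paths"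
  unfolding low_path_def by (rule lightlike_pathsI) (simp_all add: low_corner_lightlike)

lemma low_path_ends [simp]: "path_start (low_path p q) = p" "path_end (low_path p q) = q"
  unfolding low_path_def by (simp_all add: polygonal_path_start_end del: polygonal_path.simps)

lemma lightlike_paths_weakly_right:
  assumes "\<gamma> \<in> lightlike_paths"
  shows "weakly_right (path_start \<gamma>) (path_end \<gamma>)"
proof -
  obtain ps where "\<gamma> = polygonal_path ps" "ps \<noteq> []"
    and "successively (\<lambda>p q. up_right p q \<or> down_right p q) ps"
    using assms unfolding lightlike_paths_def by blast
  then show ?thesis
  proof (induction ps arbitrary: \<gamma> rule: polygonal_path.induct)
    case (2 p q ps)
    have "weakly_right p q"
      using "2.prems"(3) by (auto simp: weakly_right_def up_right_iff down_right_iff)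
    moreover have "weakly_right q (path_end (polygonal_path (q # ps)))"
      using "2.IH"[OF refl] "2.prems"(3) polygonal_path_start_end[of "q # ps"] by simp
    ultimately show ?case
      using weakly_right_trans[of p q] by (simp add: "2.prems"(1)) (simp add: path_start_def)
  qed (simp_all add: path_start_def path_end_def)
qed

section \<open>A glued region is determined by its boundary\<close>

text \<open>
  Containing the end points is part of the notion: two graphs with a common end then meet there, which
  is what makes concatenations graphs again.
\<close>
definition is_graph :: "path \<Rightarrow> bool" where
  "is_graph \<gamma> \<longleftrightarrow> path_start \<gamma> \<in> path_points \<gamma> \<and> path_end \<gamma> \<in> path_points \<gamma> \<and>
     fst ` path_points \<gamma> = {fst (path_start \<gamma>)..fst (path_end \<gamma>)} \<and> inj_on fst (path_points \<gamma>)"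

lemma is_graph_concat:
  assumes \<gamma>: "is_graph \<gamma>" and \<delta>: "is_graph \<delta>" and "path_end \<gamma> = path_start \<delta>"
  shows "is_graph (path_concat \<gamma> \<delta>)"
proof -
  let ?x = "fst (path_start \<delta>)"
  have le: "fst (path_start \<gamma>) \<le> ?x" "?x \<le> fst (path_end \<delta>)"
    using assms unfolding is_graph_def by (metis atLeastAtMost_iff imageI)+
  have "z = w" if z: "z \<in> path_points \<gamma>" and w: "w \<in> path_points \<delta>" and "fst z = fst w" for z w
  proof -
    have "fst z \<le> ?x" "?x \<le> fst w"
      using assms z w unfolding is_graph_def by (metis atLeastAtMost_iff imageI)+
    then have "fst z = ?x" "fst w = ?x" using \<open>fst z = fst w\<close> by auto
    then have "z = path_start \<delta>" "w = path_start \<delta>"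
      using assms z w unfolding is_graph_def inj_on_def by metis+
    then show ?thesis by simp
  qed
  then have "inj_on fst (path_points \<gamma> \<union> path_points \<delta>)"
    using assms unfolding is_graph_def inj_on_def by (metis Un_iff)
  then show ?thesis
    using assms le unfolding is_graph_def by (simp add: image_Un ivl_disj_un)
qed

lemma is_graph_segment:
  assumes "up_right p q \<or> down_right p q"
  shows "is_graph (p, closed_segment p q, q)"
proof -
  have "\<exists>s\<ge>0. fst q = fst p + s"
    using assms by (auto simp: up_right_def down_right_def)
  then have "fst p \<le> fst q" by auto
  then have "fst ` closed_segment p q = {fst p..fst q}"
    using closed_segment_linear_image[OF linear_fst, of p q] by (simp add: closed_segment_eq_real_ivl)
  moreover have "inj_on fst (closed_segment p q)"
  proof (rule inj_onI)
    fix z w assume "z \<in> closed_segment p q" "w \<in> closed_segment p q" "fst z = fst w"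
    from assms show "z = w"
    proof
      assume pq: "up_right p q"
      have "fst z - snd z = fst w - snd w"
        using \<open>z \<in> _\<close> \<open>w \<in> _\<close> unfolding closed_segment_up_right[OF pq] up_right_iff by linarith
      with \<open>fst z = fst w\<close> show "z = w" by (simp add: prod_eq_iff)
    next
      assume pq: "down_right p q"
      have "fst z + snd z = fst w + snd w"
        using \<open>z \<in> _\<close> \<open>w \<in> _\<close> unfolding closed_segment_down_right[OF pq] down_right_iff by linarith
      with \<open>fst z = fst w\<close> show "z = w" by (simp add: prod_eq_iff)
    qed
  qed
  ultimately show ?thesis
    by (simp add: is_graph_def path_start_def path_end_def path_points_def)
qed

lemma lightlike_paths_graph:
  assumes "\<gamma> \<in> lightlike_paths"
  shows "is_graph \<gamma>"
proof -
  obtain ps where "\<gamma> = polygonal_path ps" "ps \<noteq> []"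
    and "successively (\<lambda>p q. up_right p q \<or> down_right p q) ps"
    using assms unfolding lightlike_paths_def by blast
  then show ?thesis
  proof (induction ps arbitrary: \<gamma> rule: polygonal_path.induct)
    case (2 p q ps)
    then have "is_graph (polygonal_path (q # ps))" by simp
    then show ?case
      using "2.prems"(3) polygonal_path_start_end[of "q # ps"]
      by (auto simp: "2.prems"(1) is_graph_segment path_end_def intro!: is_graph_concat)
  qed (simp_all add: is_graph_def path_start_def path_end_def path_points_def)
qed

text \<open>
  Heights are compared only over common \<open>x\<close>-coordinates, so this carries information for paths with the
  same ends.
\<close>
definition lies_above :: "path \<Rightarrow> path \<Rightarrow> bool" where
  "lies_above \<gamma> \<delta> \<longleftrightarrow>
     (\<forall>x t1 t2. (x, t1) \<in> path_points \<gamma> \<longrightarrow> (x, t2) \<in> path_points \<delta> \<longrightarrow> t2 \<le> t1)"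

lemma is_graph_unique:
  "is_graph \<gamma> \<Longrightarrow> (x, t) \<in> path_points \<gamma> \<Longrightarrow> (x, t') \<in> path_points \<gamma> \<Longrightarrow> t = t'"
  unfolding is_graph_def inj_on_def by fastforce

lemma is_graph_transfer:
  assumes "is_graph \<gamma>" "is_graph \<delta>" "path_start \<gamma> = path_start \<delta>" "path_end \<gamma> = path_end \<delta>"
    "(x, t) \<in> path_points \<gamma>"
  obtains t' where "(x, t') \<in> path_points \<delta>"
proof -
  have "x \<in> fst ` path_points \<delta>"
    using assms unfolding is_graph_def by (metis fst_conv imageI)
  then show ?thesis using that by auto
qed

lemma region_between_iff:
  "(x, t) \<in> region_between \<gamma> \<delta> \<longleftrightarrow>
     (\<exists>t1 t2. (x, t1) \<in> path_points \<gamma> \<and> (x, t2) \<in> path_points \<delta> \<and> t2 \<le> t \<and> t \<le> t1)"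
  by (simp add: region_between_def)

lemma region_between_degenerate:
  assumes "is_graph \<gamma>"
  shows "region_between \<gamma> \<gamma> = path_points \<gamma>"
proof (rule Set.set_eqI)
  fix z :: event
  obtain x t where z: "z = (x, t)" by (cases z)
  have "z \<in> path_points \<gamma>" if "(x, t1) \<in> path_points \<gamma>" "(x, t2) \<in> path_points \<gamma>" "t2 \<le> t" "t \<le> t1" for t1 t2
    using is_graph_unique[OF assms that(1,2)] that z by simp
  then show "z \<in> region_between \<gamma> \<gamma> \<longleftrightarrow> z \<in> path_points \<gamma>"
    unfolding z region_between_iff by blast
qed

text \<open>
  Over each \<open>x\<close> the three graphs give three ordered heights, and the region is glued from two
  consecutive intervals. Without the ordering the middle graph could leave the outer region.
\<close>
lemma region_between_vertical:
  assumes g: "is_graph \<gamma>" "is_graph \<delta>" "is_graph \<epsilon>"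
    and s: "path_start \<gamma> = path_start \<delta>" "path_start \<delta> = path_start \<epsilon>"
    and e: "path_end \<gamma> = path_end \<delta>" "path_end \<delta> = path_end \<epsilon>"
    and above: "lies_above \<gamma> \<delta>" "lies_above \<delta> \<epsilon>"
  shows "region_between \<gamma> \<delta> \<union> region_between \<delta> \<epsilon> = region_between \<gamma> \<epsilon>" and "lies_above \<gamma> \<epsilon>"
proof -
  have *: "\<exists>t. (x, t) \<in> path_points \<delta>" if "(x, t1) \<in> path_points \<gamma>" for x t1
    using is_graph_transfer[OF g(1,2) s(1) e(1) that] by metis
  have **: "\<exists>t. (x, t) \<in> path_points \<epsilon>" if "(x, t1) \<in> path_points \<delta>" for x t1
    using is_graph_transfer[OF g(2,3) s(2) e(2) that] by metis
  have ***: "\<exists>t. (x, t) \<in> path_points \<gamma>" if "(x, t1) \<in> path_points \<delta>" for x t1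
    using is_graph_transfer[OF g(2,1) s(1)[symmetric] e(1)[symmetric] that] by metis
  show "lies_above \<gamma> \<epsilon>"
    using above * unfolding lies_above_def by (meson order_trans)
  show "region_between \<gamma> \<delta> \<union> region_between \<delta> \<epsilon> = region_between \<gamma> \<epsilon>"
  proof (intro equalityI subrelI)
    fix x t assume "(x, t) \<in> region_between \<gamma> \<delta> \<union> region_between \<delta> \<epsilon>"
    then show "(x, t) \<in> region_between \<gamma> \<epsilon>"
    proof
      assume "(x, t) \<in> region_between \<gamma> \<delta>"
      then show ?thesis
        using above(2) ** unfolding region_between_iff lies_above_def by (meson order_trans)
    next
      assume "(x, t) \<in> region_between \<delta> \<epsilon>"
      then show ?thesis
        using above(1) *** unfolding region_between_iff lies_above_def by (meson order_trans)
    qed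
  next
    fix x t assume "(x, t) \<in> region_between \<gamma> \<epsilon>"
    then show "(x, t) \<in> region_between \<gamma> \<delta> \<union> region_between \<delta> \<epsilon>"
      using * unfolding region_between_iff Un_iff by (meson linear)
  qed
qed

lemma is_graph_common_end:
  assumes "is_graph \<gamma>" "is_graph \<delta>'" "path_end \<gamma> = path_start \<delta>'"
    and "(x, t1) \<in> path_points \<gamma>" "(x, t2) \<in> path_points \<delta>'"
  shows "(x, t1) = path_end \<gamma>" "(x, t2) = path_end \<gamma>"
proof -
  have "x \<le> fst (path_end \<gamma>)" "fst (path_end \<gamma>) \<le> x"
    using assms unfolding is_graph_def by (metis atLeastAtMost_iff fst_conv imageI)+
  then have "x = fst (path_end \<gamma>)" by simp
  then show "(x, t1) = path_end \<gamma>" "(x, t2) = path_end \<gamma>"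
    using assms is_graph_unique[OF assms(1), of x] is_graph_unique[OF assms(2), of x]
    unfolding is_graph_def by (metis prod.collapse)+
qed

text \<open>
  A fibre of the glued region could mix a path on the left with a path on the right of the gluing point.
  That happens only over the gluing point itself, where all four paths pass through the same event.
\<close>
lemma region_between_horizontal:
  assumes g: "is_graph \<gamma>" "is_graph \<delta>" "is_graph \<gamma>'" "is_graph \<delta>'"
    and e: "path_end \<gamma> = path_end \<delta>" "path_start \<gamma>' = path_start \<delta>'" "path_end \<gamma> = path_start \<gamma>'"
    and above: "lies_above \<gamma> \<delta>" "lies_above \<gamma>' \<delta>'"
  shows "region_between (path_concat \<gamma> \<gamma>') (path_concat \<delta> \<delta>') = region_between \<gamma> \<delta> \<union> region_between \<gamma>' \<delta>'"
    and "lies_above (path_concat \<gamma> \<gamma>') (path_concat \<delta> \<delta>')"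
proof -
  have end_in: "path_end \<gamma> \<in> path_points \<gamma>" "path_end \<gamma> \<in> path_points \<delta>"
    using g e unfolding is_graph_def by metis+
  have 1: "(x, t1) = path_end \<gamma> \<and> (x, t2) = path_end \<gamma>"
    if "(x, t1) \<in> path_points \<gamma>" "(x, t2) \<in> path_points \<delta>'" for x t1 t2
    using is_graph_common_end[OF g(1,4) _ that] e by simp
  have 2: "(x, t1) = path_end \<gamma> \<and> (x, t2) = path_end \<gamma>"
    if "(x, t1) \<in> path_points \<gamma>'" "(x, t2) \<in> path_points \<delta>" for x t1 t2
    using is_graph_common_end[OF g(2,3) _ that(2,1)] e by simp
  show "lies_above (path_concat \<gamma> \<gamma>') (path_concat \<delta> \<delta>')"
    unfolding lies_above_def
  proof (intro allI impI)
    fix x t1 t2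
    assume "(x, t1) \<in> path_points (path_concat \<gamma> \<gamma>')" "(x, t2) \<in> path_points (path_concat \<delta> \<delta>')"
    then show "t2 \<le> t1"
      using 1[of x t1 t2] 2[of x t1 t2] above unfolding lies_above_def
      by (metis Pair_inject Un_iff order_refl path_concat_start_end(3))
  qed
  show "region_between (path_concat \<gamma> \<gamma>') (path_concat \<delta> \<delta>') = region_between \<gamma> \<delta> \<union> region_between \<gamma>' \<delta>'"
  proof (intro equalityI subrelI)
    fix x t assume "(x, t) \<in> region_between (path_concat \<gamma> \<gamma>') (path_concat \<delta> \<delta>')"
    then obtain t1 t2 where z: "t2 \<le> t" "t \<le> t1"
      "(x, t1) \<in> path_points \<gamma> \<or> (x, t1) \<in> path_points \<gamma>'"
      "(x, t2) \<in> path_points \<delta> \<or> (x, t2) \<in> path_points \<delta>'"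
      unfolding region_between_iff by auto
    consider "(x, t1) \<in> path_points \<gamma>" "(x, t2) \<in> path_points \<delta>"
      | "(x, t1) \<in> path_points \<gamma>'" "(x, t2) \<in> path_points \<delta>'"
      | "(x, t1) = path_end \<gamma>" "(x, t2) = path_end \<gamma>"
      using z(3,4) 1 2 by blast
    then show "(x, t) \<in> region_between \<gamma> \<delta> \<union> region_between \<gamma>' \<delta>'"
    proof cases
      case 3
      then have "(x, t1) \<in> path_points \<gamma>" "(x, t2) \<in> path_points \<delta>" using end_in by simp_all
      then show ?thesis using z unfolding region_between_iff Un_iff by blast
    qed (use z in \<open>auto simp: region_between_iff\<close>)
  qed (auto simp: region_between_iff)
qed

text \<open>
  In null coordinates the closed rectangle is given by two upper and two lower bounds on the time at
  a fixed \<open>x\<close>. The smaller upper bound is attained on the future boundary, the larger lower bound on the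
  past boundary.
\<close>
lemma causal_region_between:
  assumes "causal_subset U"
  shows "closure U = region_between (future_boundary U) (past_boundary U)"
    and "lies_above (future_boundary U) (past_boundary U)"
proof -
  obtain a a' b b' where ab: "a < a'" "b < b'"
    and c: "closure U = {q. a \<le> fst q + snd q \<and> fst q + snd q \<le> a' \<and> b \<le> fst q - snd q \<and> fst q - snd q \<le> b'}"
    using assms by (rule causal_subset_rectangle)
  note k = corners_rectangle[OF ab c]
  have lt: "up_right (left_corner U) (top_vertex U)"
    and br: "up_right (bottom_vertex U) (right_corner U)"
    and lb: "down_right (left_corner U) (bottom_vertex U)"
    and tr: "down_right (top_vertex U) (right_corner U)"
    unfolding k up_right_iff down_right_iff using ab by (auto simp: field_simps)
  have F: "(x, t) \<in> path_points (future_boundary U) \<longleftrightarrow>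
      x - t = b \<and> a \<le> x + t \<and> x + t \<le> a' \<or> x + t = a' \<and> b \<le> x - t \<and> x - t \<le> b'" for x t
    unfolding future_boundary_def using lt tr ab
    by (simp add: path_concat_def path_points_def closed_segment_up_right closed_segment_down_right)
       (auto simp: k up_right_iff down_right_iff field_simps)
  have P: "(x, t) \<in> path_points (past_boundary U) \<longleftrightarrow>
      x + t = a \<and> b \<le> x - t \<and> x - t \<le> b' \<or> x - t = b' \<and> a \<le> x + t \<and> x + t \<le> a'" for x t
    unfolding past_boundary_def using lb br ab
    by (simp add: path_concat_def path_points_def closed_segment_up_right closed_segment_down_right)
       (auto simp: k up_right_iff down_right_iff field_simps)
  show "lies_above (future_boundary U) (past_boundary U)"
    unfolding lies_above_def F P using ab by auto
  have "z \<in> closure U \<longleftrightarrow> z \<in> region_between (future_boundary U) (past_boundary U)" for z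
  proof (cases z)
    case (Pair x t)
    show ?thesis
    proof
      assume "z \<in> closure U"
      then have z: "a \<le> x + t" "x + t \<le> a'" "b \<le> x - t" "x - t \<le> b'" by (simp_all add: c Pair)
      define t1 where "t1 = min (a' - x) (x - b)"
      define t2 where "t2 = max (a - x) (x - b')"
      have "(x, t1) \<in> path_points (future_boundary U)" "(x, t2) \<in> path_points (past_boundary U)"
        unfolding F P t1_def t2_def using z ab by (auto simp: min_def max_def)
      moreover have "t2 \<le> t" "t \<le> t1" unfolding t1_def t2_def using z by auto
      ultimately show "z \<in> region_between (future_boundary U) (past_boundary U)"
        unfolding region_between_def Pair by blast
    next
      assume "z \<in> region_between (future_boundary U) (past_boundary U)"
      then obtain t1 t2 where "t2 \<le> t" "t \<le> t1"
        "(x, t1) \<in> path_points (future_boundary U)" "(x, t2) \<in> path_points (past_boundary U)"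
        unfolding region_between_def Pair by auto
      then show "z \<in> closure U" unfolding F P c Pair using ab by auto
    qed
  qed
  then show "closure U = region_between (future_boundary U) (past_boundary U)" by blast
qed

text \<open>
  Induction over the gluing. The ordering of the boundary paths is carried along because vertical gluing
  relies on it.
\<close>
lemma glued_region_determined:
  "(\<gamma>, R, \<delta>) \<in> glued_regions \<Longrightarrow> R = region_between \<gamma> \<delta> \<and> lies_above \<gamma> \<delta>"
proof (induction \<gamma> R \<delta> rule: glued_regions.induct)
  case (degenerate \<gamma>)
  then have "is_graph \<gamma>" by (rule lightlike_paths_graph)
  then show ?case
    using region_between_degenerate is_graph_unique unfolding lies_above_def by (metis order_refl)
next
  case (causal U)
  then show ?case using causal_region_between by blast
next
  case (vertical \<gamma> R \<delta> S \<epsilon>)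
  then show ?case
    using region_between_vertical[of \<gamma> \<delta> \<epsilon>] glued_regions_paths[OF vertical.hyps(1)]
      glued_regions_paths[OF vertical.hyps(2)] lightlike_paths_graph by metis
next
  case (horizontal \<gamma> R \<delta> \<gamma>' S \<delta>')
  then show ?case
    using region_between_horizontal[of \<gamma> \<delta> \<gamma>' \<delta>'] glued_regions_paths[OF horizontal.hyps(1)]
      glued_regions_paths[OF horizontal.hyps(2)] lightlike_paths_graph by metis
qed

section \<open>Every path descends to the lowest path\<close>

text \<open>
  The closed rectangle is recovered from its interior because it is closed and convex and its interior
  is not empty.
\<close>
lemma causal_subset_of_corners:
  assumes "a < a'" "b < b'"
  obtains U where "causal_subset U"
    "closure U = {q. a \<le> fst q + snd q \<and> fst q + snd q \<le> a' \<and> b \<le> fst q - snd q \<and> fst q - snd q \<le> b'}"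
proof -
  let ?K = "{q::event. a \<le> fst q + snd q \<and> fst q + snd q \<le> a' \<and> b \<le> fst q - snd q \<and> fst q - snd q \<le> b'}"
  let ?V = "{q::event. a < fst q + snd q \<and> fst q + snd q < a' \<and> b < fst q - snd q \<and> fst q - snd q < b'}"
  let ?m = "((a + b') / 2, (a - b') / 2)" and ?n = "((a' + b) / 2, (a' - b) / 2)"
  have K: "future ?m \<inter> past ?n = ?K"
    unfolding Set.set_eq_iff causal_diamond_iff by (simp add: field_simps)
  have "?K = {q. (1, 1) \<bullet> q \<ge> a} \<inter> {q. (1, 1) \<bullet> q \<le> a'} \<inter> {q. (1, -1) \<bullet> q \<ge> b} \<inter> {q. (1, -1) \<bullet> q \<le> b'}"
    by (auto simp: inner_prod_def)
  then have "convex ?K" "closed ?K"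
    by (auto intro!: convex_Int closed_Int convex_halfspace_le convex_halfspace_ge
        closed_halfspace_le closed_halfspace_ge)
  have "open ?V"
    by (intro open_Collect_conj open_Collect_less continuous_intros)
  then have "?V \<subseteq> interior ?K" by (intro interior_maximal) auto
  moreover have "((a + a' + b + b') / 4, (a + a' - b - b') / 4) \<in> ?V"
    using assms by (simp add: field_simps)
  ultimately have ne: "interior ?K \<noteq> {}" by blast
  show ?thesis
  proof (rule that)
    show "causal_subset (interior ?K)"
      unfolding causal_subset_def using ne K by metis
    show "closure (interior ?K) = ?K"
      using convex_closure_interior[OF \<open>convex ?K\<close> ne] \<open>closed ?K\<close> by simp
  qed
qed

lemma polygonal_path_insert:
  assumes "m \<in> closed_segment p q"
  shows "polygonal_path (p # m # q # ps) = polygonal_path (p # q # ps)"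
  using Un_closed_segment[OF assms]
  by (simp add: path_concat_assoc[symmetric]) (simp add: path_concat_def path_points_def path_start_def path_end_def)

text \<open>
  The elementary move. If both steps are proper, the paths bound a causal subset. Otherwise the rectangle
  collapses, both paths are equal, and the degenerate region does the job.
\<close>
lemma rectangle_cell:
  assumes "up_right p n" "down_right n q"
  shows "\<exists>R. (polygonal_path [p, n, q], R, low_path p q) \<in> glued_regions"
proof (cases "p = n \<or> n = q")
  case True
  have "polygonal_path [p, n, q] = low_path p q"
    using True
  proof
    assume "p = n"
    then have "low_corner p q = q"
      using assms by (intro null_coordinates_eqI) (simp_all add: down_right_iff)
    then show ?thesis
      using \<open>p = n\<close> polygonal_path_insert[of p p q "[]"] polygonal_path_insert[of q p q "[]"]
      unfolding low_path_def by simp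
  next
    assume "n = q"
    then have "low_corner p q = p"
      using assms by (intro null_coordinates_eqI) (simp_all add: up_right_iff)
    then show ?thesis
      using \<open>n = q\<close> polygonal_path_insert[of p p q "[]"] polygonal_path_insert[of q p q "[]"]
      unfolding low_path_def by simp
  qed
  moreover have "polygonal_path [p, n, q] \<in> lightlike_paths"
    using assms by (intro lightlike_pathsI) simp_all
  ultimately show ?thesis using glued_regions.degenerate by metis
next
  case False
  define a a' b b' where "a = fst p + snd p" and "a' = fst n + snd n"
    and "b = fst n - snd n" and "b' = fst q - snd q"
  have eqs: "fst p - snd p = b" "fst q + snd q = a'"
    using assms by (auto simp: up_right_iff down_right_iff a'_def b_def)
  have "a < a'" "b < b'"
    using assms False null_coordinates_eqI[of p n] null_coordinates_eqI[of n q]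
    unfolding up_right_iff down_right_iff a_def a'_def b_def b'_def by fastforce+
  then obtain U where U: "causal_subset U"
    "closure U = {q. a \<le> fst q + snd q \<and> fst q + snd q \<le> a' \<and> b \<le> fst q - snd q \<and> fst q - snd q \<le> b'}"
    by (rule causal_subset_of_corners)
  note k = corners_rectangle[OF \<open>a < a'\<close> \<open>b < b'\<close> U(2)]
  have "left_corner U = p" "right_corner U = q" "bottom_vertex U = low_corner p q" "top_vertex U = n"
    using eqs unfolding k
    by (auto intro!: null_coordinates_eqI simp: field_simps a_def[symmetric] a'_def[symmetric] b_def[symmetric] b'_def[symmetric])
       (auto simp: a_def a'_def b_def b'_def)
  then show ?thesis
    using glued_regions.causal[OF U(1)] unfolding future_boundary_def past_boundary_def low_path_def
    by metis
qed

text \<open>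
  Induction over the corners. The tail descends to its lowest path. If the first step goes up, one
  rectangle swaps it with the downward leg of that lowest path, after which the two upward legs are
  collinear. If it goes down, it is collinear with that downward leg and nothing remains to be done.
\<close>
lemma path_to_low_path_ex:
  assumes "\<gamma> \<in> lightlike_paths"
  shows "\<exists>R. (\<gamma>, R, low_path (path_start \<gamma>) (path_end \<gamma>)) \<in> glued_regions"
proof -
  obtain ps where "\<gamma> = polygonal_path ps" "ps \<noteq> []"
    and "successively (\<lambda>p q. up_right p q \<or> down_right p q) ps"
    using assms unfolding lightlike_paths_def by blast
  then show ?thesis
  proof (induction ps arbitrary: \<gamma> rule: polygonal_path.induct)
    case (1 p)
    have "\<gamma> \<in> lightlike_paths" using 1 lightlike_pathsI[of "[p]"] by simp
    moreover have "low_corner p p = p" by (intro null_coordinates_eqI) simp_all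
    then have "low_path p p = \<gamma>"
      by (simp add: 1 low_path_def path_concat_def path_points_def path_start_def path_end_def)
    ultimately show ?case
      using 1 glued_regions.degenerate[of \<gamma>] by (auto simp: path_start_def path_end_def)
  next
    case (2 p q ps)
    define \<delta> where "\<delta> = polygonal_path (q # ps)"
    define r where "r = path_end \<delta>"
    define e where "e = (p, closed_segment p q, q)"
    have pq: "up_right p q \<or> down_right p q" using 2 by simp
    have e: "e = polygonal_path [p, q]"
      by (auto simp: e_def path_concat_def path_start_def path_end_def path_points_def)
    then have e_path: "e \<in> lightlike_paths" using pq lightlike_pathsI[of "[p, q]"] by simp
    have \<delta>: "\<delta> \<in> lightlike_paths" "path_start \<delta> = q"
      using 2 lightlike_pathsI[of "q # ps"] polygonal_path_start_end[of "q # ps"] unfolding \<delta>_def by auto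
    have \<gamma>: "\<gamma> = path_concat e \<delta>" using 2 by (simp add: \<delta>_def e_def)
    have e_ends: "path_start e = p" "path_end e = q"
      by (simp_all add: e_def path_start_def path_end_def)
    have qr: "weakly_right q r" using lightlike_paths_weakly_right[OF \<delta>(1)] \<delta>(2) r_def by simp
    obtain R where "(\<delta>, R, low_path q r) \<in> glued_regions"
      using "2.IH"[OF \<delta>_def] 2 \<delta>(2) unfolding r_def by auto
    then have 1: "(\<gamma>, path_points e \<union> R, path_concat e (low_path q r)) \<in> glued_regions"
      using glued_regions.horizontal[OF glued_regions.degenerate[OF e_path]] \<delta>(2) e_ends
      unfolding \<gamma> by (metis glued_regions_paths)
    have tgt: "path_concat e (low_path q r) = polygonal_path [p, q, low_corner q r, r]"
      by (simp add: low_path_def e_def)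
    have "\<exists>S. (path_concat e (low_path q r), S, low_path p r) \<in> glued_regions"
    proof (cases "up_right p q")
      case True
      let ?m = "low_corner q r"
      have down: "down_right q ?m" and up: "up_right ?m r" using low_corner_lightlike[OF qr] by auto
      obtain S where S: "(polygonal_path [p, q, ?m], S, low_path p ?m) \<in> glued_regions"
        using rectangle_cell[OF True down] by blast
      let ?f = "polygonal_path [?m, r]"
      have f: "?f \<in> lightlike_paths" using up by (intro lightlike_pathsI) simp_all
      have "(path_concat (polygonal_path [p, q, ?m]) ?f, S \<union> path_points ?f,
          path_concat (low_path p ?m) ?f) \<in> glued_regions"
        by (rule glued_regions.horizontal[OF S glued_regions.degenerate[OF f]])
           (simp add: polygonal_path_start_end del: polygonal_path.simps)
      moreover have "path_concat (polygonal_path [p, q, ?m]) ?f = path_concat e (low_path q r)"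
        using polygonal_path_append[of "[p, q, ?m]" "[?m, r]"] tgt by simp
      \<comment> \<open>After the swap the two upward legs are collinear.\<close>
      moreover have "path_concat (low_path p ?m) ?f = low_path p r"
      proof -
        have m: "low_corner p ?m = low_corner p r" by (intro null_coordinates_eqI) simp_all
        have "?m \<in> closed_segment (low_corner p r) r"
          using True qr
          by (subst closed_segment_up_right)
             (auto simp: up_right_iff weakly_right_def)
        then have "polygonal_path [low_corner p r, ?m, r] = polygonal_path [low_corner p r, r]"
          by (rule polygonal_path_insert)
        then show ?thesis
          using polygonal_path_append[of "[p, low_corner p r, ?m]" "[?m, r]"]
          unfolding low_path_def m by (metis append_Cons append_Nil hd_conv_nth last.simps list.sel(1,3)
            list.distinct(1) polygonal_path.simps(2))
      qed
      ultimately show ?thesis by metis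
    next
      case False
      then have d: "down_right p q" using pq by simp
      have m: "low_corner q r = low_corner p r"
        using d by (intro null_coordinates_eqI) (simp_all add: down_right_iff)
      have "q \<in> closed_segment p (low_corner p r)"
        using d qr by (subst closed_segment_down_right) (auto simp: down_right_iff weakly_right_def)
      then have "polygonal_path [p, q, low_corner p r, r] = low_path p r"
        unfolding low_path_def by (rule polygonal_path_insert)
      then have "path_concat e (low_path q r) = low_path p r"
        by (simp only: tgt m)
      moreover have "path_concat e (low_path q r) \<in> lightlike_paths"
        using glued_regions_paths[OF 1] by simp
      ultimately show ?thesis using glued_regions.degenerate by metis
    qed
    then obtain S where "(path_concat e (low_path q r), S, low_path p r) \<in> glued_regions" ..
    from glued_regions.vertical[OF 1 this] show ?case
      unfolding \<gamma> by (auto simp: e_ends r_def)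
  qed simp
qed

section \<open>Whiskering and conjugation in strict 2-groupoids\<close>

definition (in strict_2_category) homs :: "'o \<Rightarrow> 'o \<Rightarrow> 'a set" where
  "homs x y = {f \<in> arrs C. src1 C f = x \<and> tgt1 C f = y}"

definition (in strict_2_category) hom2 :: "'o \<Rightarrow> 'o \<Rightarrow> 'a \<Rightarrow> 'a \<Rightarrow> 'c set" where
  "hom2 x y f g = {\<alpha> \<in> cells C. src2 C \<alpha> = f \<and> tgt2 C \<alpha> = g \<and> f \<in> homs x y}"

context strict_2_category
begin

lemma hom2_parallel:
  assumes "\<alpha> \<in> hom2 x y f g"
  shows "f \<in> homs x y" "g \<in> homs x y"
  using assms src1_globular tgt1_globular tgt2_closed unfolding hom2_def homs_def by auto

lemma hom2_id: "f \<in> homs x y \<Longrightarrow> id2 C f \<in> hom2 x y f f"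
  by (simp add: hom2_def homs_def id2_closed src2_id2 tgt2_id2)

lemma homs_comp: "f \<in> homs x y \<Longrightarrow> g \<in> homs y z \<Longrightarrow> f \<cdot> g \<in> homs x z"
  by (simp add: homs_def comp1_closed src1_comp1 tgt1_comp1)

lemma homs_assoc: "f \<in> homs w x \<Longrightarrow> g \<in> homs x y \<Longrightarrow> h \<in> homs y z \<Longrightarrow> f \<cdot> g \<cdot> h = f \<cdot> (g \<cdot> h)"
  by (simp add: homs_def comp1_assoc)

lemma hom2_vcomp: "\<alpha> \<in> hom2 x y f g \<Longrightarrow> \<beta> \<in> hom2 x y g h \<Longrightarrow> \<beta> \<odot> \<alpha> \<in> hom2 x y f h"
  by (simp add: hom2_def vcomp_closed src2_vcomp tgt2_vcomp)

lemma hom2_hcomp: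
  "\<alpha> \<in> hom2 x y f g \<Longrightarrow> \<beta> \<in> hom2 y z f' g' \<Longrightarrow> \<alpha> \<star> \<beta> \<in> hom2 x z (f \<cdot> f') (g \<cdot> g')"
  using homs_comp[of f x y f' z]
  by (simp add: hom2_def homs_def hcomp_closed src2_hcomp tgt2_hcomp)

lemma hom2_vcomp_assoc:
  "\<alpha> \<in> hom2 x y f g \<Longrightarrow> \<beta> \<in> hom2 x y g h \<Longrightarrow> \<gamma> \<in> hom2 x y h k \<Longrightarrow>
     \<gamma> \<odot> \<beta> \<odot> \<alpha> = \<gamma> \<odot> (\<beta> \<odot> \<alpha>)"
  by (simp add: hom2_def vcomp_assoc)

lemma hom2_hcomp_assoc:
  "\<alpha> \<in> hom2 w x f f' \<Longrightarrow> \<beta> \<in> hom2 x y g g' \<Longrightarrow> \<gamma> \<in> hom2 y z h h' \<Longrightarrow>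
     \<alpha> \<star> \<beta> \<star> \<gamma> = \<alpha> \<star> (\<beta> \<star> \<gamma>)"
  by (simp add: hom2_def homs_def hcomp_assoc)

lemma hom2_unit:
  assumes "\<alpha> \<in> hom2 x y f g"
  shows "\<alpha> \<odot> id2 C f = \<alpha>" "id2 C g \<odot> \<alpha> = \<alpha>"
    "id2 C (id1 C x) \<star> \<alpha> = \<alpha>" "\<alpha> \<star> id2 C (id1 C y) = \<alpha>"
  using assms vcomp_id2_right vcomp_id2_left hcomp_id_left hcomp_id_right
  unfolding hom2_def homs_def by auto

lemma hom2_id_hcomp: "f \<in> homs x y \<Longrightarrow> g \<in> homs y z \<Longrightarrow> id2 C f \<star> id2 C g = id2 C (f \<cdot> g)"
  by (simp add: homs_def hcomp_id2)

lemma hom2_interchange: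
  "\<alpha> \<in> hom2 x y f g \<Longrightarrow> \<beta> \<in> hom2 x y g h \<Longrightarrow> \<alpha>' \<in> hom2 y z f' g' \<Longrightarrow> \<beta>' \<in> hom2 y z g' h' \<Longrightarrow>
     (\<beta> \<odot> \<alpha>) \<star> (\<beta>' \<odot> \<alpha>') = (\<beta> \<star> \<beta>') \<odot> (\<alpha> \<star> \<alpha>')"
  by (simp add: hom2_def homs_def interchange)

lemma hom2_whisker:
  "g \<in> homs w x \<Longrightarrow> \<alpha> \<in> hom2 x y f f' \<Longrightarrow> h \<in> homs y z \<Longrightarrow>
     whisker C g \<alpha> h \<in> hom2 w z (g \<cdot> f \<cdot> h) (g \<cdot> f' \<cdot> h)"
  unfolding whisker_def by (intro hom2_hcomp hom2_id)

lemma whisker_id: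
  "g \<in> homs w x \<Longrightarrow> f \<in> homs x y \<Longrightarrow> h \<in> homs y z \<Longrightarrow> whisker C g (id2 C f) h = id2 C (g \<cdot> f \<cdot> h)"
  unfolding whisker_def using hom2_id_hcomp homs_comp by metis

lemma whisker_vcomp:
  assumes g: "g \<in> homs w x" and \<alpha>: "\<alpha> \<in> hom2 x y e f" and \<beta>: "\<beta> \<in> hom2 x y f k" and h: "h \<in> homs y z"
  shows "whisker C g (\<beta> \<odot> \<alpha>) h = whisker C g \<beta> h \<odot> whisker C g \<alpha> h"
proof -
  note ig = hom2_id[OF g] and ih = hom2_id[OF h]
  have "(id2 C g \<odot> id2 C g) \<star> (\<beta> \<odot> \<alpha>) \<star> (id2 C h \<odot> id2 C h)
      = (id2 C g \<star> \<beta> \<star> id2 C h) \<odot> (id2 C g \<star> \<alpha> \<star> id2 C h)"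
    using hom2_interchange[OF ig ig \<alpha> \<beta>] hom2_interchange[OF hom2_hcomp[OF ig \<alpha>] hom2_hcomp[OF ig \<beta>] ih ih]
    by simp
  then show ?thesis
    unfolding whisker_def by (simp add: hom2_unit[OF ig] hom2_unit[OF ih])
qed

lemma whisker_whisker:
  assumes "g \<in> homs v w" "g' \<in> homs w x" "\<alpha> \<in> hom2 x y e f" "h' \<in> homs y z" "h \<in> homs z z'"
  shows "whisker C g (whisker C g' \<alpha> h') h = whisker C (g \<cdot> g') \<alpha> (h' \<cdot> h)"
proof -
  note i = hom2_id[OF assms(1)] hom2_id[OF assms(2)] assms(3) hom2_id[OF assms(4)] hom2_id[OF assms(5)]
  have "id2 C g \<star> (id2 C g' \<star> \<alpha> \<star> id2 C h') \<star> id2 C h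
      = id2 C g \<star> (id2 C g' \<star> \<alpha>) \<star> id2 C h' \<star> id2 C h"
    by (simp only: hom2_hcomp_assoc[OF i(1) hom2_hcomp[OF i(2,3)] i(4)])
  also have "\<dots> = id2 C g \<star> (id2 C g' \<star> \<alpha>) \<star> (id2 C h' \<star> id2 C h)"
    by (rule hom2_hcomp_assoc[OF hom2_hcomp[OF i(1) hom2_hcomp[OF i(2,3)]] i(4,5)])
  also have "\<dots> = id2 C g \<star> id2 C g' \<star> \<alpha> \<star> (id2 C h' \<star> id2 C h)"
    by (simp only: hom2_hcomp_assoc[OF i(1-3)])
  finally show ?thesis
    using hom2_id_hcomp[OF assms(1,2)] hom2_id_hcomp[OF assms(4,5)] by (simp add: whisker_def)
qed

text \<open>
  Observables placed side by side on the path \<open>g k r l h\<close> act on disjoint factors of a horizontal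
  composite, hence commute by interchange.
\<close>
lemma whiskers_commute:
  assumes g: "g \<in> homs v w" and a: "a \<in> hom2 w x k k" and r: "r \<in> homs x x'"
    and b: "b \<in> hom2 x' y l l" and h: "h \<in> homs y z"
  shows "whisker C g a (r \<cdot> l \<cdot> h) \<odot> whisker C (g \<cdot> k \<cdot> r) b h
    = whisker C (g \<cdot> k \<cdot> r) b h \<odot> whisker C g a (r \<cdot> l \<cdot> h)"
proof -
  note k = hom2_parallel(1)[OF a] and l = hom2_parallel(1)[OF b]
  note gk = homs_comp[OF g k] and rlh = homs_comp[OF homs_comp[OF r l] h]
  have A: "id2 C g \<star> a \<in> hom2 v x (g \<cdot> k) (g \<cdot> k)" by (rule hom2_hcomp[OF hom2_id[OF g] a])
  have B: "id2 C r \<star> b \<star> id2 C h \<in> hom2 x z (r \<cdot> l \<cdot> h) (r \<cdot> l \<cdot> h)"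
    using hom2_whisker[OF r b h] by (simp add: whisker_def)
  have "id2 C (g \<cdot> k \<cdot> r) = id2 C (g \<cdot> k) \<star> id2 C r" using hom2_id_hcomp[OF gk r] by simp
  then have W: "whisker C (g \<cdot> k \<cdot> r) b h = id2 C (g \<cdot> k) \<star> (id2 C r \<star> b \<star> id2 C h)"
    unfolding whisker_def
    using hom2_hcomp_assoc[OF hom2_id[OF gk] hom2_id[OF r] b]
      hom2_hcomp_assoc[OF hom2_id[OF gk] hom2_hcomp[OF hom2_id[OF r] b] hom2_id[OF h]] by simp
  show ?thesis
    unfolding W unfolding whisker_def
    using hom2_interchange[OF hom2_id[OF gk] A B hom2_id[OF rlh]]
      hom2_interchange[OF A hom2_id[OF gk] hom2_id[OF rlh] B]
      hom2_unit[OF A] hom2_unit[OF B] by metis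
qed

end

context strict_2_groupoid
begin

lemma inverse_cells_unique:
  assumes "inverse_cells C \<alpha> \<beta>" "inverse_cells C \<alpha> \<gamma>"
  shows "\<beta> = \<gamma>"
proof -
  have "\<beta> = \<beta> \<odot> (\<alpha> \<odot> \<gamma>)"
    using assms vcomp_id2_right unfolding inverse_cells_def by metis
  also have "\<dots> = \<beta> \<odot> \<alpha> \<odot> \<gamma>"
    using assms vcomp_assoc unfolding inverse_cells_def by metis
  also have "\<dots> = \<gamma>"
    using assms vcomp_id2_left unfolding inverse_cells_def by metis
  finally show ?thesis .
qed

lemma vinverse_inverse_cells: "\<alpha> \<in> cells C \<Longrightarrow> inverse_cells C \<alpha> (vinverse C \<alpha>)"
  unfolding vinverse_def using cells_invertible inverse_cells_unique theI[of "inverse_cells C \<alpha>"] by blast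

lemma hom2_vinverse:
  assumes "\<alpha> \<in> hom2 x y f g"
  shows "vinverse C \<alpha> \<in> hom2 x y g f" "vinverse C \<alpha> \<odot> \<alpha> = id2 C f" "\<alpha> \<odot> vinverse C \<alpha> = id2 C g"
  using assms vinverse_inverse_cells[of \<alpha>] hom2_parallel[OF assms] unfolding hom2_def inverse_cells_def by auto

definition conjugate :: "'c \<Rightarrow> 'c \<Rightarrow> 'c" where
  "conjugate \<alpha> a = \<alpha> \<odot> a \<odot> vinverse C \<alpha>"

lemma conjugate_closed: "\<alpha> \<in> hom2 x y f g \<Longrightarrow> a \<in> hom2 x y f f \<Longrightarrow> conjugate \<alpha> a \<in> hom2 x y g g"
  unfolding conjugate_def by (rule hom2_vcomp[OF hom2_vinverse(1) hom2_vcomp])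

text \<open>An intertwining relation characterises the conjugate, so identities of conjugates need no inverses.\<close>
lemma conjugate_eqI:
  assumes "\<alpha> \<in> hom2 x y f g" "a \<in> hom2 x y f f" "b \<in> hom2 x y g g" "\<alpha> \<odot> a = b \<odot> \<alpha>"
  shows "conjugate \<alpha> a = b"
  unfolding conjugate_def assms(4)
  using hom2_vcomp_assoc[OF hom2_vinverse(1) assms(1) assms(3)] hom2_vinverse(3) hom2_unit assms by metis

lemma conjugate_intertwines:
  assumes "\<alpha> \<in> hom2 x y f g" "a \<in> hom2 x y f f"
  shows "\<alpha> \<odot> a = conjugate \<alpha> a \<odot> \<alpha>"
proof -
  have "conjugate \<alpha> a \<odot> \<alpha> = \<alpha> \<odot> a \<odot> (vinverse C \<alpha> \<odot> \<alpha>)"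
    unfolding conjugate_def
    using hom2_vcomp_assoc[OF assms(1) hom2_vinverse(1)[OF assms(1)] hom2_vcomp[OF assms(2,1)]] .
  then show ?thesis
    using hom2_vinverse(2)[OF assms(1)] hom2_unit(1)[OF hom2_vcomp[OF assms(2,1)]] by simp
qed

lemma conjugate_id: "a \<in> hom2 x y f f \<Longrightarrow> conjugate (id2 C f) a = a"
  using conjugate_eqI[OF hom2_id] hom2_unit hom2_parallel by metis

lemma conjugate_conjugate:
  assumes \<alpha>: "\<alpha> \<in> hom2 x y f g" and \<beta>: "\<beta> \<in> hom2 x y g h" and a: "a \<in> hom2 x y f f"
  shows "conjugate \<beta> (conjugate \<alpha> a) = conjugate (\<beta> \<odot> \<alpha>) a"
proof (rule conjugate_eqI[symmetric, OF hom2_vcomp[OF \<alpha> \<beta>] a])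
  note c = conjugate_closed[OF \<alpha> a]
  note d = conjugate_closed[OF \<beta> c]
  show "conjugate \<beta> (conjugate \<alpha> a) \<in> hom2 x y h h" by (rule d)
  have "\<beta> \<odot> \<alpha> \<odot> a = \<beta> \<odot> (conjugate \<alpha> a \<odot> \<alpha>)"
    using hom2_vcomp_assoc[OF a \<alpha> \<beta>] conjugate_intertwines[OF \<alpha> a] by simp
  also have "\<dots> = conjugate \<beta> (conjugate \<alpha> a) \<odot> \<beta> \<odot> \<alpha>"
    using hom2_vcomp_assoc[OF \<alpha> c \<beta>] conjugate_intertwines[OF \<beta> c] by simp
  finally show "\<beta> \<odot> \<alpha> \<odot> a = conjugate \<beta> (conjugate \<alpha> a) \<odot> (\<beta> \<odot> \<alpha>)"
    using hom2_vcomp_assoc[OF \<alpha> \<beta> d] by simp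
qed

lemma conjugate_mult:
  assumes \<alpha>: "\<alpha> \<in> hom2 x y f g" and a: "a \<in> hom2 x y f f" and b: "b \<in> hom2 x y f f"
  shows "conjugate \<alpha> (a \<odot> b) = conjugate \<alpha> a \<odot> conjugate \<alpha> b"
proof (rule conjugate_eqI[OF \<alpha> hom2_vcomp[OF b a]])
  note ca = conjugate_closed[OF \<alpha> a] and cb = conjugate_closed[OF \<alpha> b]
  show "conjugate \<alpha> a \<odot> conjugate \<alpha> b \<in> hom2 x y g g" by (rule hom2_vcomp[OF cb ca])
  have "\<alpha> \<odot> (a \<odot> b) = conjugate \<alpha> a \<odot> (\<alpha> \<odot> b)"
    using hom2_vcomp_assoc[OF b a \<alpha>] hom2_vcomp_assoc[OF b \<alpha> ca] conjugate_intertwines[OF \<alpha> a] by simp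
  then show "\<alpha> \<odot> (a \<odot> b) = conjugate \<alpha> a \<odot> conjugate \<alpha> b \<odot> \<alpha>"
    using hom2_vcomp_assoc[OF \<alpha> cb ca] conjugate_intertwines[OF \<alpha> b] by simp
qed

lemma conjugate_one: "\<alpha> \<in> hom2 x y f g \<Longrightarrow> conjugate \<alpha> (id2 C f) = id2 C g"
  using conjugate_eqI hom2_id hom2_unit hom2_parallel by metis

lemma conjugate_bij:
  assumes \<alpha>: "\<alpha> \<in> hom2 x y f g"
  shows "bij_betw (conjugate \<alpha>) (hom2 x y f f) (hom2 x y g g)"
proof (rule bij_betw_byWitness[where f' = "conjugate (vinverse C \<alpha>)"])
  note v = hom2_vinverse[OF \<alpha>]
  show "\<forall>a\<in>hom2 x y f f. conjugate (vinverse C \<alpha>) (conjugate \<alpha> a) = a"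
    using conjugate_conjugate[OF \<alpha> v(1)] conjugate_id v(2) by simp
  show "\<forall>b\<in>hom2 x y g g. conjugate \<alpha> (conjugate (vinverse C \<alpha>) b) = b"
    using conjugate_conjugate[OF v(1) \<alpha>] conjugate_id v(3) by simp
qed (auto intro: conjugate_closed[OF \<alpha>] conjugate_closed[OF hom2_vinverse(1)[OF \<alpha>]])

text \<open>Whiskering by the inverse 1-morphisms undoes whiskering, because the calculus is strict.\<close>
lemma whisker_bij:
  assumes g: "g \<in> homs w x" and f: "f \<in> homs x y" and h: "h \<in> homs y z"
  shows "bij_betw (\<lambda>a. whisker C g a h) (hom2 x y f f) (hom2 w z (g \<cdot> f \<cdot> h) (g \<cdot> f \<cdot> h))"
proof -
  obtain g' where "inverse_arrs C g g'" using arrs_invertible g unfolding homs_def by blast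
  then have g': "g' \<in> homs x w" "g' \<cdot> g = id1 C x" "g \<cdot> g' = id1 C w"
    using g unfolding inverse_arrs_def homs_def by auto
  obtain h' where "inverse_arrs C h h'" using arrs_invertible h unfolding homs_def by blast
  then have h': "h' \<in> homs z y" "h \<cdot> h' = id1 C y" "h' \<cdot> h = id1 C z"
    using h unfolding inverse_arrs_def homs_def by auto
  have unit: "whisker C (id1 C s) a (id1 C t) = a" if "a \<in> hom2 s t k k" for a s t k
    unfolding whisker_def using hom2_unit[OF that] by simp
  note gf = homs_comp[OF g f]
  note gfh = homs_comp[OF gf h]
  have unit1: "id1 C s \<cdot> k = k" "k \<cdot> id1 C t = k" if "k \<in> homs s t" for s t k
    using that comp1_id1_left comp1_id1_right unfolding homs_def by auto
  have "g' \<cdot> (g \<cdot> f \<cdot> h) = g' \<cdot> g \<cdot> f \<cdot> h"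
    using homs_assoc[OF g'(1) g f] homs_assoc[OF g'(1) gf h] by simp
  then have "g' \<cdot> (g \<cdot> f \<cdot> h) \<cdot> h' = f"
    using unit1[OF f] homs_assoc[OF f h h'(1)] g' h' by simp
  then have unwhiskered: "whisker C g' b h' \<in> hom2 x y f f" if "b \<in> hom2 w z (g \<cdot> f \<cdot> h) (g \<cdot> f \<cdot> h)" for b
    using hom2_whisker[OF g'(1) that h'(1)] by simp
  show ?thesis
  proof (rule bij_betw_byWitness[where f' = "\<lambda>b. whisker C g' b h'"])
    show "\<forall>a\<in>hom2 x y f f. whisker C g' (whisker C g a h) h' = a"
      using whisker_whisker[OF g'(1) g _ h h'(1)] unit g' h' by simp
    show "\<forall>b\<in>hom2 w z (g \<cdot> f \<cdot> h) (g \<cdot> f \<cdot> h). whisker C g (whisker C g' b h') h = b"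
      using whisker_whisker[OF g g'(1) _ h'(1) h] unit g' h' by simp
  qed (auto intro: hom2_whisker[OF g _ h] unwhiskered)
qed

lemma whisker_conjugate:
  assumes g: "g \<in> homs w x" and \<alpha>: "\<alpha> \<in> hom2 x y e f" and a: "a \<in> hom2 x y e e" and h: "h \<in> homs y z"
  shows "whisker C g (conjugate \<alpha> a) h = conjugate (whisker C g \<alpha> h) (whisker C g a h)"
proof (rule conjugate_eqI[symmetric])
  note c = conjugate_closed[OF \<alpha> a]
  show "whisker C g \<alpha> h \<in> hom2 w z (g \<cdot> e \<cdot> h) (g \<cdot> f \<cdot> h)" by (rule hom2_whisker[OF g \<alpha> h])
  show "whisker C g a h \<in> hom2 w z (g \<cdot> e \<cdot> h) (g \<cdot> e \<cdot> h)" by (rule hom2_whisker[OF g a h])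
  show "whisker C g (conjugate \<alpha> a) h \<in> hom2 w z (g \<cdot> f \<cdot> h) (g \<cdot> f \<cdot> h)" by (rule hom2_whisker[OF g c h])
  show "whisker C g \<alpha> h \<odot> whisker C g a h = whisker C g (conjugate \<alpha> a) h \<odot> whisker C g \<alpha> h"
    using whisker_vcomp[OF g a \<alpha> h] whisker_vcomp[OF g \<alpha> c h] conjugate_intertwines[OF \<alpha> a] by simp
qed

text \<open>
  Changing the whiskers does not disturb what sits between them: both composites with
  \<open>\<alpha> \<star> id \<star> \<beta>\<close> are equal to \<open>\<alpha> \<star> a \<star> \<beta>\<close> by interchange.
\<close>
lemma conjugate_whisker_slide:
  assumes \<alpha>: "\<alpha> \<in> hom2 w x g g'" and a: "a \<in> hom2 x y k k" and \<beta>: "\<beta> \<in> hom2 y z h h'"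
  shows "conjugate (\<alpha> \<star> id2 C k \<star> \<beta>) (whisker C g a h) = whisker C g' a h'"
proof (rule conjugate_eqI)
  note k = hom2_parallel(1)[OF a] and g = hom2_parallel[OF \<alpha>] and h = hom2_parallel[OF \<beta>]
  note ik = hom2_id[OF k] and ig = hom2_id[OF g(1)] hom2_id[OF g(2)]
    and ih = hom2_id[OF h(1)] hom2_id[OF h(2)]
  show "\<alpha> \<star> id2 C k \<star> \<beta> \<in> hom2 w z (g \<cdot> k \<cdot> h) (g' \<cdot> k \<cdot> h')"
    by (rule hom2_hcomp[OF hom2_hcomp[OF \<alpha> ik] \<beta>])
  show "whisker C g a h \<in> hom2 w z (g \<cdot> k \<cdot> h) (g \<cdot> k \<cdot> h)" by (rule hom2_whisker[OF g(1) a h(1)])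
  show "whisker C g' a h' \<in> hom2 w z (g' \<cdot> k \<cdot> h') (g' \<cdot> k \<cdot> h')" by (rule hom2_whisker[OF g(2) a h(2)])
  have "(\<alpha> \<star> id2 C k \<star> \<beta>) \<odot> whisker C g a h = \<alpha> \<star> a \<star> \<beta>"
    unfolding whisker_def
    using hom2_interchange[OF hom2_hcomp[OF ig(1) a] hom2_hcomp[OF \<alpha> ik] ih(1) \<beta>]
      hom2_interchange[OF ig(1) \<alpha> a ik] hom2_unit[OF \<alpha>] hom2_unit[OF \<beta>] hom2_unit[OF a] by simp
  moreover have "whisker C g' a h' \<odot> (\<alpha> \<star> id2 C k \<star> \<beta>) = \<alpha> \<star> a \<star> \<beta>"
    unfolding whisker_def
    using hom2_interchange[OF hom2_hcomp[OF \<alpha> ik] hom2_hcomp[OF ig(2) a] \<beta> ih(2)]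
      hom2_interchange[OF \<alpha> ig(2) ik a] hom2_unit[OF \<alpha>] hom2_unit[OF \<beta>] hom2_unit[OF a] by simp
  ultimately show "(\<alpha> \<star> id2 C k \<star> \<beta>) \<odot> whisker C g a h = whisker C g' a h' \<odot> (\<alpha> \<star> id2 C k \<star> \<beta>)"
    by simp
qed

end

section \<open>The hom-categories of lightlike paths\<close>

lemma P2_sel:
  "arrs P2 = lightlike_paths" "cells P2 = glued_regions" "src1 P2 = path_start" "tgt1 P2 = path_end"
  "src2 P2 \<alpha> = fst \<alpha>" "tgt2 P2 \<alpha> = snd (snd \<alpha>)" "objs P2 = UNIV"
  "id1 P2 p = (p, {p}, p)" "comp1 P2 = path_concat"
  by (simp_all add: P2_def)

interpretation P2: strict_2_category P2
  by (rule P2_strict_2_category)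

lemma P2_homs_iff: "\<gamma> \<in> P2.homs p q \<longleftrightarrow> \<gamma> \<in> lightlike_paths \<and> path_start \<gamma> = p \<and> path_end \<gamma> = q"
  by (simp add: P2.homs_def P2_sel)

lemma P2_hom2_iff:
  "\<alpha> \<in> P2.hom2 p q \<gamma> \<delta> \<longleftrightarrow>
     \<alpha> \<in> glued_regions \<and> fst \<alpha> = \<gamma> \<and> snd (snd \<alpha>) = \<delta> \<and> path_start \<gamma> = p \<and> path_end \<gamma> = q"
  using glued_regions_paths[of "fst \<alpha>" "fst (snd \<alpha>)" "snd (snd \<alpha>)"]
  by (auto simp: P2.hom2_def P2_homs_iff P2_sel)

text \<open>
  This is what turns every coherence condition between regions into a mere comparison of source and
  target.
\<close>
lemma P2_hom2_unique:
  assumes "\<alpha> \<in> P2.hom2 p q \<gamma> \<delta>" "\<beta> \<in> P2.hom2 p q \<gamma> \<delta>"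
  shows "\<alpha> = \<beta>"
  using assms glued_region_determined[of \<gamma> "fst (snd \<alpha>)" \<delta>] glued_region_determined[of \<gamma> "fst (snd \<beta>)" \<delta>]
  unfolding P2_hom2_iff by (metis prod.collapse)

text \<open>The morphism to the terminal object of the hom-category; the region is forced by its boundary.\<close>
definition descent :: "path \<Rightarrow> path_region" where
  "descent \<gamma> = (let \<delta> = low_path (path_start \<gamma>) (path_end \<gamma>) in (\<gamma>, region_between \<gamma> \<delta>, \<delta>))"

lemma descent_hom2:
  assumes "\<gamma> \<in> P2.homs p q"
  shows "descent \<gamma> \<in> P2.hom2 p q \<gamma> (low_path p q)"
proof -
  obtain R where R: "(\<gamma>, R, low_path p q) \<in> glued_regions"
    using path_to_low_path_ex[of \<gamma>] assms unfolding P2_homs_iff by auto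
  then have "descent \<gamma> = (\<gamma>, R, low_path p q)"
    using glued_region_determined[OF R] assms unfolding P2_homs_iff descent_def by (simp add: Let_def)
  then show ?thesis using R assms unfolding P2_hom2_iff P2_homs_iff by simp
qed

lemma low_path_homs: "weakly_right p q \<Longrightarrow> low_path p q \<in> P2.homs p q"
  by (simp add: P2_homs_iff)

lemma P2_homs_weakly_right: "\<gamma> \<in> P2.homs p q \<Longrightarrow> weakly_right p q"
  using lightlike_paths_weakly_right unfolding P2_homs_iff by blast

lemma low_path_refl: "low_path p p = id1 P2 p"
proof -
  have "low_corner p p = p" by (intro null_coordinates_eqI) simp_all
  then show ?thesis
    by (simp add: low_path_def P2_sel path_concat_def path_points_def path_start_def path_end_def)
qed

lemma descent_low_path:
  assumes "weakly_right p q"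
  shows "descent (low_path p q) = id2 P2 (low_path p q)"
  using P2_hom2_unique[OF descent_hom2 P2.hom2_id] low_path_homs[OF assms] by blast


section \<open>Transport of observables\<close>

locale extended_field_theory = strict_2_groupoid C + strict_2_functor P2 C Z
  for C :: "('o, 'a, 'c) two_category" (structure)
    and Z :: "(event, path, path_region, 'o, 'a, 'c) two_functor"
begin

lemma Z_homs: "\<gamma> \<in> P2.homs p q \<Longrightarrow> on_arrs Z \<gamma> \<in> homs (on_objs Z p) (on_objs Z q)"
  by (auto simp: homs_def P2.homs_def on_arrs_closed map_src1 map_tgt1)

lemma Z_hom2:
  "\<alpha> \<in> P2.hom2 p q \<gamma> \<delta> \<Longrightarrow>
     on_cells Z \<alpha> \<in> hom2 (on_objs Z p) (on_objs Z q) (on_arrs Z \<gamma>) (on_arrs Z \<delta>)"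
  using Z_homs by (auto simp: hom2_def P2.hom2_def on_cells_closed map_src2 map_tgt2)

lemma Z_comp:
  "\<gamma> \<in> P2.homs p q \<Longrightarrow> \<delta> \<in> P2.homs q r \<Longrightarrow> on_arrs Z (\<gamma> \<cdot>\<^bsub>P2\<^esub> \<delta>) = on_arrs Z \<gamma> \<cdot> on_arrs Z \<delta>"
  by (auto simp: P2.homs_def map_comp1)

lemma Z_vcomp:
  "\<alpha> \<in> P2.hom2 p q \<gamma> \<delta> \<Longrightarrow> \<beta> \<in> P2.hom2 p q \<delta> \<epsilon> \<Longrightarrow>
     on_cells Z (\<beta> \<odot>\<^bsub>P2\<^esub> \<alpha>) = on_cells Z \<beta> \<odot> on_cells Z \<alpha>"
  by (auto simp: P2.hom2_def map_vcomp)

lemma Z_hcomp: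
  "\<alpha> \<in> P2.hom2 p q \<gamma> \<delta> \<Longrightarrow> \<beta> \<in> P2.hom2 q r \<gamma>' \<delta>' \<Longrightarrow>
     on_cells Z (\<alpha> \<star>\<^bsub>P2\<^esub> \<beta>) = on_cells Z \<alpha> \<star> on_cells Z \<beta>"
  by (auto simp: P2.hom2_def P2.homs_def map_hcomp)

lemma Z_id2: "\<gamma> \<in> P2.homs p q \<Longrightarrow> on_cells Z (id2 P2 \<gamma>) = id2 C (on_arrs Z \<gamma>)"
  by (auto simp: P2.homs_def map_id2)

lemma Z_whisker:
  assumes "\<sigma> \<in> P2.homs p p'" "\<alpha> \<in> P2.hom2 p' q' \<gamma> \<delta>" "\<rho> \<in> P2.homs q' q"
  shows "on_cells Z (whisker P2 \<sigma> \<alpha> \<rho>) = whisker C (on_arrs Z \<sigma>) (on_cells Z \<alpha>) (on_arrs Z \<rho>)"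
  unfolding whisker_def
  using Z_hcomp[OF P2.hom2_hcomp[OF P2.hom2_id[OF assms(1)] assms(2)] P2.hom2_id[OF assms(3)]]
    Z_hcomp[OF P2.hom2_id[OF assms(1)] assms(2)] Z_id2[OF assms(1)] Z_id2[OF assms(3)] by simp

text \<open>For the corners \<open>p\<close>, \<open>q\<close> of a causal subset this is the carrier of its monoid.\<close>
abbreviation "observables p q \<equiv>
  hom2 (on_objs Z p) (on_objs Z q) (on_arrs Z (low_path p q)) (on_arrs Z (low_path p q))"

text \<open>The lowest path bridges the gap between the end of \<open>\<sigma>\<close> and the start of \<open>\<rho>\<close>.\<close>
definition transport :: "path \<Rightarrow> path \<Rightarrow> 'c \<Rightarrow> 'c" where
  "transport \<sigma> \<rho> a =
     conjugate (on_cells Z (descent (\<sigma> \<cdot>\<^bsub>P2\<^esub> low_path (path_end \<sigma>) (path_start \<rho>) \<cdot>\<^bsub>P2\<^esub> \<rho>)))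
       (whisker C (on_arrs Z \<sigma>) a (on_arrs Z \<rho>))"

context
  fixes p p' q' q \<sigma> \<rho>
  assumes \<sigma>: "\<sigma> \<in> P2.homs p p'" and \<rho>: "\<rho> \<in> P2.homs q' q" and right: "weakly_right p' q'"
begin

lemma detour: "\<sigma> \<cdot>\<^bsub>P2\<^esub> low_path p' q' \<cdot>\<^bsub>P2\<^esub> \<rho> \<in> P2.homs p q"
  by (rule P2.homs_comp[OF P2.homs_comp[OF \<sigma> low_path_homs[OF right]] \<rho>])

lemma Z_detour:
  "on_arrs Z (\<sigma> \<cdot>\<^bsub>P2\<^esub> low_path p' q' \<cdot>\<^bsub>P2\<^esub> \<rho>) = on_arrs Z \<sigma> \<cdot> on_arrs Z (low_path p' q') \<cdot> on_arrs Z \<rho>"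
  using Z_comp[OF \<sigma> low_path_homs[OF right]]
    Z_comp[OF P2.homs_comp[OF \<sigma> low_path_homs[OF right]] \<rho>] by simp

lemma Z_descent:
  "on_cells Z (descent (\<sigma> \<cdot>\<^bsub>P2\<^esub> low_path p' q' \<cdot>\<^bsub>P2\<^esub> \<rho>)) \<in> hom2 (on_objs Z p) (on_objs Z q)
     (on_arrs Z \<sigma> \<cdot> on_arrs Z (low_path p' q') \<cdot> on_arrs Z \<rho>) (on_arrs Z (low_path p q))"
  using Z_hom2[OF descent_hom2[OF detour]] unfolding Z_detour .

lemma transport_eq:
  "transport \<sigma> \<rho> a = conjugate (on_cells Z (descent (\<sigma> \<cdot>\<^bsub>P2\<^esub> low_path p' q' \<cdot>\<^bsub>P2\<^esub> \<rho>)))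
     (whisker C (on_arrs Z \<sigma>) a (on_arrs Z \<rho>))"
  using \<sigma> \<rho> by (simp add: transport_def P2_homs_iff)

lemma transport_bij: "bij_betw (transport \<sigma> \<rho>) (observables p' q') (observables p q)"
proof -
  have "bij_betw (conjugate (on_cells Z (descent (\<sigma> \<cdot>\<^bsub>P2\<^esub> low_path p' q' \<cdot>\<^bsub>P2\<^esub> \<rho>)))
      \<circ> (\<lambda>a. whisker C (on_arrs Z \<sigma>) a (on_arrs Z \<rho>))) (observables p' q') (observables p q)"
    by (rule bij_betw_trans[OF whisker_bij conjugate_bij[OF Z_descent]])
      (intro Z_homs \<sigma> \<rho> low_path_homs right)+
  then show ?thesis by (simp add: transport_eq comp_def cong: bij_betw_cong)
qed

lemma transport_closed: "a \<in> observables p' q' \<Longrightarrow> transport \<sigma> \<rho> a \<in> observables p q"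
  using transport_bij bij_betwE by blast

lemma transport_mult:
  assumes "a \<in> observables p' q'" "b \<in> observables p' q'"
  shows "transport \<sigma> \<rho> (a \<odot> b) = transport \<sigma> \<rho> a \<odot> transport \<sigma> \<rho> b"
  unfolding transport_eq whisker_vcomp[OF Z_homs[OF \<sigma>] assms(2,1) Z_homs[OF \<rho>]]
  by (rule conjugate_mult[OF Z_descent]) (intro hom2_whisker[OF Z_homs[OF \<sigma>] _ Z_homs[OF \<rho>]] assms)+

lemma transport_one:
  "transport \<sigma> \<rho> (id2 C (on_arrs Z (low_path p' q'))) = id2 C (on_arrs Z (low_path p q))"
  unfolding transport_eq
    whisker_id[OF Z_homs[OF \<sigma>] Z_homs[OF low_path_homs[OF right]] Z_homs[OF \<rho>]]
  by (rule conjugate_one[OF Z_descent])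

text \<open>
  The descent of the detour along \<open>\<sigma>\<close> and \<open>\<rho>\<close> factors, by uniqueness, through the descents of \<open>\<sigma>\<close> and \<open>\<rho>\<close>
  themselves. Conjugation by the first factor merely exchanges the whiskers.
\<close>
lemma transport_independent:
  assumes a: "a \<in> observables p' q'"
  shows "transport \<sigma> \<rho> a = transport (low_path p p') (low_path q' q) a"
proof -
  let ?k = "low_path p' q'" and ?l = "low_path p p'" and ?r = "low_path q' q"
  note l = low_path_homs[OF P2_homs_weakly_right[OF \<sigma>]] and r = low_path_homs[OF P2_homs_weakly_right[OF \<rho>]]
    and k = low_path_homs[OF right]
  \<comment> \<open>This region lowers both whiskers and is degenerate along the middle path.\<close>
  let ?s = "descent \<sigma> \<star>\<^bsub>P2\<^esub> id2 P2 ?k \<star>\<^bsub>P2\<^esub> descent \<rho>"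
  note ds = descent_hom2[OF \<sigma>] and dr = descent_hom2[OF \<rho>]
  have s: "?s \<in> P2.hom2 p q (\<sigma> \<cdot>\<^bsub>P2\<^esub> ?k \<cdot>\<^bsub>P2\<^esub> \<rho>) (?l \<cdot>\<^bsub>P2\<^esub> ?k \<cdot>\<^bsub>P2\<^esub> ?r)"
    by (rule P2.hom2_hcomp[OF P2.hom2_hcomp[OF ds P2.hom2_id[OF k]] dr])
  have lkr: "?l \<cdot>\<^bsub>P2\<^esub> ?k \<cdot>\<^bsub>P2\<^esub> ?r \<in> P2.homs p q" by (rule P2.homs_comp[OF P2.homs_comp[OF l k] r])
  note d = descent_hom2[OF lkr]
  have Zs: "on_cells Z ?s = on_cells Z (descent \<sigma>) \<star> id2 C (on_arrs Z ?k) \<star> on_cells Z (descent \<rho>)"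
    using Z_hcomp[OF P2.hom2_hcomp[OF ds P2.hom2_id[OF k]] dr] Z_hcomp[OF ds P2.hom2_id[OF k]] Z_id2[OF k]
    by simp
  have "descent (\<sigma> \<cdot>\<^bsub>P2\<^esub> ?k \<cdot>\<^bsub>P2\<^esub> \<rho>) = descent (?l \<cdot>\<^bsub>P2\<^esub> ?k \<cdot>\<^bsub>P2\<^esub> ?r) \<odot>\<^bsub>P2\<^esub> ?s"
    by (rule P2_hom2_unique[OF descent_hom2[OF detour] P2.hom2_vcomp[OF s d]])
  then have "transport \<sigma> \<rho> a
      = conjugate (on_cells Z (descent (?l \<cdot>\<^bsub>P2\<^esub> ?k \<cdot>\<^bsub>P2\<^esub> ?r)) \<odot> on_cells Z ?s)
          (whisker C (on_arrs Z \<sigma>) a (on_arrs Z \<rho>))"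
    unfolding transport_eq using Z_vcomp[OF s d] by simp
  also have "\<dots> = conjugate (on_cells Z (descent (?l \<cdot>\<^bsub>P2\<^esub> ?k \<cdot>\<^bsub>P2\<^esub> ?r)))
      (conjugate (on_cells Z ?s) (whisker C (on_arrs Z \<sigma>) a (on_arrs Z \<rho>)))"
    by (rule conjugate_conjugate[symmetric, OF Z_hom2[OF s] Z_hom2[OF d]])
      (use hom2_whisker[OF Z_homs[OF \<sigma>] a Z_homs[OF \<rho>]] in \<open>simp add: Z_detour\<close>)
  also have "conjugate (on_cells Z ?s) (whisker C (on_arrs Z \<sigma>) a (on_arrs Z \<rho>))
      = whisker C (on_arrs Z ?l) a (on_arrs Z ?r)"
    unfolding Zs by (rule conjugate_whisker_slide[OF Z_hom2[OF ds] a Z_hom2[OF dr]])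
  finally show ?thesis by (simp add: transport_def)
qed

end

text \<open>
  Descending first inside the inner detour and then along the outer one is a region with the same
  boundary as the descent of the combined detour, hence equal to it.
\<close>
lemma transport_transport:
  assumes \<sigma>: "\<sigma> \<in> P2.homs p p'" and \<sigma>': "\<sigma>' \<in> P2.homs p' p''"
    and \<rho>': "\<rho>' \<in> P2.homs q'' q'" and \<rho>: "\<rho> \<in> P2.homs q' q"
    and right: "weakly_right p'' q''" and a: "a \<in> observables p'' q''"
  shows "transport \<sigma> \<rho> (transport \<sigma>' \<rho>' a) = transport (\<sigma> \<cdot>\<^bsub>P2\<^esub> \<sigma>') (\<rho>' \<cdot>\<^bsub>P2\<^esub> \<rho>) a"
proof -
  have right': "weakly_right p' q'"
    using P2_homs_weakly_right[OF \<sigma>'] P2_homs_weakly_right[OF \<rho>'] right weakly_right_trans by blast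
  let ?k = "low_path p'' q''"
  let ?\<gamma>' = "\<sigma>' \<cdot>\<^bsub>P2\<^esub> ?k \<cdot>\<^bsub>P2\<^esub> \<rho>'" and ?\<gamma> = "\<sigma> \<cdot>\<^bsub>P2\<^esub> low_path p' q' \<cdot>\<^bsub>P2\<^esub> \<rho>"
  note k = low_path_homs[OF right]
  note \<gamma>' = detour[OF \<sigma>' \<rho>' right] and \<gamma> = detour[OF \<sigma> \<rho> right']
  note d' = descent_hom2[OF \<gamma>'] and d = descent_hom2[OF \<gamma>]
  note ss = P2.homs_comp[OF \<sigma> \<sigma>'] and rr = P2.homs_comp[OF \<rho>' \<rho>]
  note D = detour[OF ss rr right]
  have assoc: "(\<sigma> \<cdot>\<^bsub>P2\<^esub> \<sigma>') \<cdot>\<^bsub>P2\<^esub> ?k \<cdot>\<^bsub>P2\<^esub> (\<rho>' \<cdot>\<^bsub>P2\<^esub> \<rho>) = \<sigma> \<cdot>\<^bsub>P2\<^esub> ?\<gamma>' \<cdot>\<^bsub>P2\<^esub> \<rho>"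
    by (simp add: P2_sel path_concat_assoc)
  note w = P2.hom2_whisker[OF \<sigma> d' \<rho>]
  have eq: "descent ((\<sigma> \<cdot>\<^bsub>P2\<^esub> \<sigma>') \<cdot>\<^bsub>P2\<^esub> ?k \<cdot>\<^bsub>P2\<^esub> (\<rho>' \<cdot>\<^bsub>P2\<^esub> \<rho>)) = descent ?\<gamma> \<odot>\<^bsub>P2\<^esub> whisker P2 \<sigma> (descent ?\<gamma>') \<rho>"
    using P2_hom2_unique[OF descent_hom2[OF D] P2.hom2_vcomp[OF w[folded assoc] d]] .
  let ?Z = "on_arrs Z"
  note Zd' = Z_descent[OF \<sigma>' \<rho>' right] and Zs = Z_homs[OF \<sigma>] and Zs' = Z_homs[OF \<sigma>']
    and Zr = Z_homs[OF \<rho>] and Zr' = Z_homs[OF \<rho>']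
  note a' = hom2_whisker[OF Zs' a Zr']
  have "transport \<sigma> \<rho> (transport \<sigma>' \<rho>' a) = conjugate (on_cells Z (descent ?\<gamma>))
      (whisker C (?Z \<sigma>) (conjugate (on_cells Z (descent ?\<gamma>')) (whisker C (?Z \<sigma>') a (?Z \<rho>'))) (?Z \<rho>))"
    unfolding transport_eq[OF \<sigma> \<rho> right'] transport_eq[OF \<sigma>' \<rho>' right] ..
  also have "\<dots> = conjugate (on_cells Z (descent ?\<gamma>))
      (conjugate (on_cells Z (whisker P2 \<sigma> (descent ?\<gamma>') \<rho>))
        (whisker C (?Z (\<sigma> \<cdot>\<^bsub>P2\<^esub> \<sigma>')) a (?Z (\<rho>' \<cdot>\<^bsub>P2\<^esub> \<rho>))))"
    unfolding whisker_conjugate[OF Zs Zd' a' Zr] whisker_whisker[OF Zs Zs' a Zr' Zr]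
      Z_whisker[OF \<sigma> d' \<rho>] Z_comp[OF \<sigma> \<sigma>'] Z_comp[OF \<rho>' \<rho>] ..
  also have "\<dots> = conjugate (on_cells Z (descent ?\<gamma>) \<odot> on_cells Z (whisker P2 \<sigma> (descent ?\<gamma>') \<rho>))
        (whisker C (?Z (\<sigma> \<cdot>\<^bsub>P2\<^esub> \<sigma>')) a (?Z (\<rho>' \<cdot>\<^bsub>P2\<^esub> \<rho>)))"
    using conjugate_conjugate[OF Z_hom2[OF w[folded assoc]] Z_hom2[OF d]]
      hom2_whisker[OF Z_homs[OF ss] a Z_homs[OF rr]] Z_detour[OF ss rr right] by simp
  also have "\<dots> = transport (\<sigma> \<cdot>\<^bsub>P2\<^esub> \<sigma>') (\<rho>' \<cdot>\<^bsub>P2\<^esub> \<rho>) a"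
    unfolding transport_eq[OF ss rr right] eq Z_vcomp[OF w d] ..
  finally show ?thesis .
qed

lemma transport_refl:
  assumes "weakly_right p q" "a \<in> observables p q"
  shows "transport (low_path p p) (low_path q q) a = a"
proof -
  note k = low_path_homs[OF assms(1)] and i = low_path_homs[OF weakly_right_refl]
  have "low_path p p \<cdot>\<^bsub>P2\<^esub> low_path p q \<cdot>\<^bsub>P2\<^esub> low_path q q = low_path p q"
    using P2.comp1_id1_left[of "low_path p q"] P2.comp1_id1_right[of "low_path p q"] k
    unfolding low_path_refl by (simp add: P2.homs_def)
  moreover have "whisker C (on_arrs Z (low_path p p)) a (on_arrs Z (low_path q q)) = a"
    unfolding low_path_refl whisker_def
    using hom2_unit[OF assms(2)] map_id1[of p] map_id1[of q] by (simp add: P2_sel)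
  ultimately show ?thesis
    unfolding transport_eq[OF i i assms(1)]
    using descent_low_path[OF assms(1)] Z_id2[OF k] conjugate_id[OF assms(2)] by simp
qed

text \<open>
  Both observables are transported along the same path, which passes through \<open>p1\<close>, \<open>q1\<close>, \<open>p2\<close>, \<open>q2\<close> in
  this order; independence of the detour permits this choice.
\<close>
lemma transports_commute:
  assumes "weakly_right p p1" "weakly_right p1 q1" "weakly_right q1 p2" "weakly_right p2 q2" "weakly_right q2 q"
    and a: "a \<in> observables p1 q1" and b: "b \<in> observables p2 q2"
  shows "transport (low_path p p1) (low_path q1 q) a \<odot> transport (low_path p p2) (low_path q2 q) b
    = transport (low_path p p2) (low_path q2 q) b \<odot> transport (low_path p p1) (low_path q1 q) a"
proof -
  let ?Z = "on_arrs Z"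
  let ?g = "low_path p p1" and ?k = "low_path p1 q1" and ?r = "low_path q1 p2"
    and ?l = "low_path p2 q2" and ?h = "low_path q2 q"
  note P = assms(1-5)[THEN low_path_homs]
  note rl = P2.homs_comp[OF P(3,4)] and gk = P2.homs_comp[OF P(1,2)]
  note rlh = P2.homs_comp[OF rl P(5)] and gkr = P2.homs_comp[OF gk P(3)]
  \<comment> \<open>The part after \<open>?k\<close> is the right whisker of \<open>a\<close>, the part before \<open>?l\<close> the left whisker of \<open>b\<close>.\<close>
  let ?\<gamma> = "?g \<cdot>\<^bsub>P2\<^esub> ?k \<cdot>\<^bsub>P2\<^esub> (?r \<cdot>\<^bsub>P2\<^esub> ?l \<cdot>\<^bsub>P2\<^esub> ?h)"
  have \<gamma>: "?g \<cdot>\<^bsub>P2\<^esub> ?k \<cdot>\<^bsub>P2\<^esub> ?r \<cdot>\<^bsub>P2\<^esub> ?l \<cdot>\<^bsub>P2\<^esub> ?h = ?\<gamma>"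
    by (simp add: P2_sel path_concat_assoc)
  let ?A = "whisker C (?Z ?g) a (?Z ?r \<cdot> ?Z ?l \<cdot> ?Z ?h)"
    and ?B = "whisker C (?Z ?g \<cdot> ?Z ?k \<cdot> ?Z ?r) b (?Z ?h)"
  have Zrlh: "?Z (?r \<cdot>\<^bsub>P2\<^esub> ?l \<cdot>\<^bsub>P2\<^esub> ?h) = ?Z ?r \<cdot> ?Z ?l \<cdot> ?Z ?h"
    using Z_comp[OF P(3,4)] Z_comp[OF rl P(5)] by simp
  have Zgkr: "?Z (?g \<cdot>\<^bsub>P2\<^esub> ?k \<cdot>\<^bsub>P2\<^esub> ?r) = ?Z ?g \<cdot> ?Z ?k \<cdot> ?Z ?r"
    using Z_comp[OF P(1,2)] Z_comp[OF gk P(3)] by simp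
  have A: "transport ?g (low_path q1 q) a = conjugate (on_cells Z (descent ?\<gamma>)) ?A"
    using transport_independent[OF P(1) rlh assms(2) a] transport_eq[OF P(1) rlh assms(2)] Zrlh by simp
  have B: "transport (low_path p p2) ?h b = conjugate (on_cells Z (descent ?\<gamma>)) ?B"
    using transport_independent[OF gkr P(5) assms(4) b] transport_eq[OF gkr P(5) assms(4)] Zgkr \<gamma> by simp
  note Z\<gamma> = Z_hom2[OF descent_hom2[OF P2.homs_comp[OF gk rlh]]]
  have A': "?A \<in> hom2 (on_objs Z p) (on_objs Z q) (?Z ?\<gamma>) (?Z ?\<gamma>)"
    using hom2_whisker[OF Z_homs[OF P(1)] a Z_homs[OF rlh]] Z_detour[OF P(1) rlh assms(2)] Zrlh by simp
  have B': "?B \<in> hom2 (on_objs Z p) (on_objs Z q) (?Z ?\<gamma>) (?Z ?\<gamma>)"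
    using hom2_whisker[OF Z_homs[OF gkr] b Z_homs[OF P(5)]] Z_detour[OF gkr P(5) assms(4)] Zgkr \<gamma> by simp
  have "?A \<odot> ?B = ?B \<odot> ?A"
    by (rule whiskers_commute[OF Z_homs[OF P(1)] a Z_homs[OF P(3)] b Z_homs[OF P(5)]])
  then show ?thesis
    unfolding A B using conjugate_mult[OF Z\<gamma> A' B'] conjugate_mult[OF Z\<gamma> B' A'] by simp
qed

end

section \<open>Causal subsets, spacelike separation and Cauchy surfaces\<close>

definition strictly_right :: "event \<Rightarrow> event \<Rightarrow> bool" where
  "strictly_right p q \<longleftrightarrow> fst p + snd p < fst q + snd q \<and> fst p - snd p < fst q - snd q"

lemma causal_subset_corners:
  assumes "causal_subset U"
  shows "strictly_right (left_corner U) (right_corner U)"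
    and "weakly_right (left_corner U) (right_corner U)"
    and "bottom_vertex U = low_corner (left_corner U) (right_corner U)"
    and "z \<in> U \<longleftrightarrow> strictly_right (left_corner U) z \<and> strictly_right z (right_corner U)"
    and "z \<in> closure U \<longleftrightarrow> weakly_right (left_corner U) z \<and> weakly_right z (right_corner U)"
proof -
  obtain a a' b b' where ab: "a < a'" "b < b'"
    and U: "U = {q. a < fst q + snd q \<and> fst q + snd q < a' \<and> b < fst q - snd q \<and> fst q - snd q < b'}"
    and c: "closure U = {q. a \<le> fst q + snd q \<and> fst q + snd q \<le> a' \<and> b \<le> fst q - snd q \<and> fst q - snd q \<le> b'}"
    using assms by (rule causal_subset_rectangle)
  note k = corners_rectangle[OF ab c]
  have l: "fst (left_corner U) + snd (left_corner U) = a" "fst (left_corner U) - snd (left_corner U) = b"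
    and r: "fst (right_corner U) + snd (right_corner U) = a'" "fst (right_corner U) - snd (right_corner U) = b'"
    unfolding k by (simp_all add: field_simps)
  show "strictly_right (left_corner U) (right_corner U)" "weakly_right (left_corner U) (right_corner U)"
    unfolding strictly_right_def weakly_right_def l r using ab by simp_all
  show "bottom_vertex U = low_corner (left_corner U) (right_corner U)"
    unfolding low_corner_def l r by (simp add: k)
  show "z \<in> U \<longleftrightarrow> strictly_right (left_corner U) z \<and> strictly_right z (right_corner U)"
    unfolding strictly_right_def l r by (subst U) auto
  show "z \<in> closure U \<longleftrightarrow> weakly_right (left_corner U) z \<and> weakly_right z (right_corner U)"
    unfolding weakly_right_def l r c by auto
qed

lemma past_boundary_low_path:
  "causal_subset U \<Longrightarrow> past_boundary U = low_path (left_corner U) (right_corner U)"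
  unfolding past_boundary_def low_path_def by (simp only: causal_subset_corners(3))

lemma causal_subset_mono_corners:
  assumes "causal_subset U'" "causal_subset U" "U' \<subseteq> U"
  shows "weakly_right (left_corner U) (left_corner U')"
    and "weakly_right (right_corner U') (right_corner U)"
proof -
  have "left_corner U' \<in> closure U'" "right_corner U' \<in> closure U'"
    using causal_subset_corners(2)[OF assms(1)] by (simp_all add: causal_subset_corners(5)[OF assms(1)])
  then show "weakly_right (left_corner U) (left_corner U')" "weakly_right (right_corner U') (right_corner U)"
    using closure_mono[OF assms(3)] causal_subset_corners(5)[OF assms(2)] by blast+
qed

lemma open_intervals_cross:
  fixes a :: real
  assumes "a < b" "c < d" "a < d"
  obtains y z where "a < y" "y < b" "c < z" "z < d" "y < z"
proof -
  obtain w where w: "a < w" "w < d" using assms dense by blast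
  obtain y where "a < y" "y < min w b" using assms w dense[of a "min w b"] by auto
  moreover obtain z where "max w c < z" "z < d" using assms w dense[of "max w c" d] by auto
  ultimately show ?thesis using that[of y z] by auto
qed

lemma open_intervals_ordered:
  fixes a :: real
  assumes "a < b" "c < d"
    and "\<And>y z. a < y \<Longrightarrow> y < b \<Longrightarrow> c < z \<Longrightarrow> z < d \<Longrightarrow> z < y"
  shows "d \<le> a"
proof (rule ccontr)
  assume "\<not> d \<le> a"
  then obtain y z where "a < y" "y < b" "c < z" "z < d" "y < z"
    using open_intervals_cross[of a b c d] assms(1,2) by auto
  then show False using assms(3)[of y z] by simp
qed

lemma spacelike_iff:
  "spacelike (q - p) \<longleftrightarrow>
     0 < ((fst q + snd q) - (fst p + snd p)) * ((fst q - snd q) - (fst p - snd p))"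
  unfolding spacelike_def minkowski_def by (simp add: algebra_simps)

text \<open>
  Spacelike separation of two events means that both null coordinates change in the same direction.
  If some point of the second set has a smaller \<open>\<xi>\<close> than some point of the first, then every \<open>\<eta>\<close> in
  the second set is below every \<open>\<eta>\<close> in the first, and in turn the same holds for \<open>\<xi>\<close>.
\<close>
lemma spacelike_separated_cases:
  assumes U1: "causal_subset U1" and U2: "causal_subset U2" and sep: "spacelike_separated U1 U2"
  shows "weakly_right (right_corner U1) (left_corner U2) \<or> weakly_right (right_corner U2) (left_corner U1)"
proof -
  \<comment> \<open>The null coordinates \<open>\<xi>\<close> (\<open>a\<close>) and \<open>\<eta>\<close> (\<open>b\<close>) of the corners; those of the points range between them.\<close>
  define a1 a1' b1 b1' where "a1 = fst (left_corner U1) + snd (left_corner U1)"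
    and "a1' = fst (right_corner U1) + snd (right_corner U1)"
    and "b1 = fst (left_corner U1) - snd (left_corner U1)"
    and "b1' = fst (right_corner U1) - snd (right_corner U1)"
  define a2 a2' b2 b2' where "a2 = fst (left_corner U2) + snd (left_corner U2)"
    and "a2' = fst (right_corner U2) + snd (right_corner U2)"
    and "b2 = fst (left_corner U2) - snd (left_corner U2)"
    and "b2' = fst (right_corner U2) - snd (right_corner U2)"
  note defs = a1_def a1'_def b1_def b1'_def a2_def a2'_def b2_def b2'_def
  have lt: "a1 < a1'" "b1 < b1'" "a2 < a2'" "b2 < b2'"
    using causal_subset_corners(1)[OF U1] causal_subset_corners(1)[OF U2]
    unfolding strictly_right_def defs by auto
  have pos: "0 < (y - x) * (w - v)"
    if "a1 < x" "x < a1'" "b1 < v" "v < b1'" "a2 < y" "y < a2'" "b2 < w" "w < b2'" for x v y w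
  proof -
    \<comment> \<open>The points with the null coordinates \<open>(x, v)\<close> and \<open>(y, w)\<close>.\<close>
    let ?p = "((x + v) / 2, (x - v) / 2)" and ?q = "((y + w) / 2, (y - w) / 2)"
    have n: "fst ?p + snd ?p = x" "fst ?p - snd ?p = v" "fst ?q + snd ?q = y" "fst ?q - snd ?q = w"
      by (simp_all add: field_simps)
    have "?p \<in> U1" "?q \<in> U2"
      using that unfolding causal_subset_corners(4)[OF U1] causal_subset_corners(4)[OF U2]
        strictly_right_def n defs by simp_all
    then have "spacelike (?q - ?p)" using sep unfolding spacelike_separated_def by blast
    then show ?thesis unfolding spacelike_iff n .
  qed
  show ?thesis
  proof (cases "a1' \<le> a2")
    case True
    have "b1' \<le> b2"
    proof (rule open_intervals_ordered[OF lt(4,2)])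
      fix w v assume *: "b2 < w" "w < b2'" "b1 < v" "v < b1'"
      obtain x y where xy: "a1 < x" "x < a1'" "a2 < y" "y < a2'" using lt dense by meson
      then have "0 < (y - x) * (w - v)" using pos * by blast
      moreover have "0 < y - x" using xy True by simp
      ultimately show "v < w" by (simp add: zero_less_mult_iff)
    qed
    then show ?thesis using True unfolding weakly_right_def defs by blast
  next
    case False
    then obtain y0 x0 where xy: "a2 < y0" "y0 < a2'" "a1 < x0" "x0 < a1'" "y0 < x0"
      using open_intervals_cross[of a2 a2' a1 a1'] lt by auto
    have less: "w < v" if "b1 < v" "v < b1'" "b2 < w" "w < b2'" for v w
      using pos[of x0 v y0 w] xy that by (simp add: zero_less_mult_iff)
    have "b2' \<le> b1" by (rule open_intervals_ordered[OF lt(2,4)]) (use less in blast)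
    moreover have "a2' \<le> a1"
    proof (rule open_intervals_ordered[OF lt(1,3)])
      fix x y assume *: "a1 < x" "x < a1'" "a2 < y" "y < a2'"
      obtain v w where vw: "b1 < v" "v < b1'" "b2 < w" "w < b2'" using lt dense by meson
      then have "0 < (y - x) * (w - v)" using pos * by blast
      then show "y < x" using less[OF vw] by (simp add: zero_less_mult_iff)
    qed
    ultimately show ?thesis unfolding weakly_right_def defs by blast
  qed
qed

text \<open>
  The straight segment from the bottom vertex \<open>m\<close> to the top vertex \<open>n\<close>, parametrised by the real line
  through \<open>tanh\<close>, is timelike: along it \<open>\<xi>\<close> increases and \<open>\<eta>\<close> decreases.
  It is inextendible because its two limits are vertices, which are not in the open rectangle.
\<close>
lemma cauchy_surface_nonempty:
  assumes "causal_subset U" "cauchy_surface U S"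
  shows "S \<noteq> {}"
proof -
  obtain a a' b b' where ab: "a < a'" "b < b'"
    and U: "U = {q. a < fst q + snd q \<and> fst q + snd q < a' \<and> b < fst q - snd q \<and> fst q - snd q < b'}"
    using assms(1) by (rule causal_subset_rectangle)
  define m :: event where "m = ((a + b') / 2, (a - b') / 2)"
  define n :: event where "n = ((a' + b) / 2, (a' - b) / 2)"
  define c where "c s = (1 / 2) *\<^sub>R (m + n) + (tanh s / 2) *\<^sub>R (n - m)" for s :: real
  define c' where "c' s = ((1 - (tanh s)\<^sup>2) / 2) *\<^sub>R (n - m)" for s :: real
  have c_eq: "c s = ((a + a' + b + b') / 4 + tanh s * (a' - a + b - b') / 4,
      (a + a' - b - b') / 4 + tanh s * (a' - a - b + b') / 4)" for s
    by (simp add: c_def m_def n_def prod_eq_iff field_simps)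
  have null: "fst (c s) + snd (c s) = (a + a') / 2 + tanh s * ((a' - a) / 2)"
    "fst (c s) - snd (c s) = (b + b') / 2 - tanh s * ((b' - b) / 2)" for s
    by (simp_all add: c_eq field_simps)
  have bound: "\<bar>tanh s * k\<bar> < k" if "0 < k" for s k :: real
    using that tanh_real_lt_1[of s] tanh_real_gt_neg1[of s] by (simp add: abs_mult abs_less_iff)
  have "c s \<in> U" for s
    using bound[of "(a' - a) / 2" s] bound[of "(b' - b) / 2" s] ab
    unfolding U mem_Collect_eq null by (auto simp: abs_less_iff field_simps)
  moreover have midpoint: "(1 / 2) *\<^sub>R (m + n) + (1 / 2) *\<^sub>R (n - m) = n"
      "(1 / 2) *\<^sub>R (m + n) + (-1 / 2) *\<^sub>R (n - m) = m"
    by (simp_all only: prod_eq_iff fst_add snd_add fst_scaleR snd_scaleR fst_diff snd_diff)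
      (simp_all add: field_simps)
  have "(c \<longlongrightarrow> (1 / 2) *\<^sub>R (m + n) + (1 / 2) *\<^sub>R (n - m)) at_top"
    unfolding c_def by (intro tendsto_intros tanh_real_at_top) simp
  then have "(c \<longlongrightarrow> n) at_top" by (simp only: midpoint(1))
  moreover have "(c \<longlongrightarrow> (1 / 2) *\<^sub>R (m + n) + (-1 / 2) *\<^sub>R (n - m)) at_bot"
    unfolding c_def by (intro tendsto_intros tanh_real_at_bot) simp
  then have "(c \<longlongrightarrow> m) at_bot" by (simp only: midpoint(2))
  moreover have "m \<notin> U" "n \<notin> U" unfolding U m_def n_def by (simp_all add: field_simps)
  ultimately have "inextendible_curve U c"
    unfolding inextendible_curve_def
    using tendsto_unique[OF trivial_limit_at_top_linorder] tendsto_unique[OF trivial_limit_at_bot_linorder]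
    by blast
  moreover have "timelike_curve c"
    unfolding timelike_curve_def
  proof (intro exI[of _ c'] conjI allI)
    show "continuous_on UNIV c'"
      unfolding c'_def by (intro continuous_intros) (auto simp: cosh_real_pos less_imp_neq[symmetric])
    fix s
    have "(tanh has_real_derivative 1 - (tanh s)\<^sup>2) (at s)"
      by (auto intro!: derivative_eq_intros)
    then have "((\<lambda>s. tanh s / 2) has_field_derivative (1 - (tanh s)\<^sup>2) / 2) (at s)"
      by (rule DERIV_cdivide)
    from has_vector_derivative_scaleR[OF this has_vector_derivative_const]
    show "(c has_vector_derivative c' s) (at s)"
      unfolding c_def c'_def using has_vector_derivative_add[OF has_vector_derivative_const] by fastforce
    have "tanh s * tanh s < 1"
      using bound[of 1 s] abs_square_less_1[of "tanh s"] by (simp add: power2_eq_square)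
    then have k: "0 < ((1 - (tanh s)\<^sup>2) / 2)" by (simp add: power2_eq_square)
    have "minkowski (k *\<^sub>R v) (k *\<^sub>R v) = k\<^sup>2 * minkowski v v" for k v
      by (simp add: minkowski_def power2_eq_square algebra_simps)
    moreover have "minkowski (n - m) (n - m) = (a' - a) * (b - b')"
      by (simp add: minkowski_def m_def n_def field_simps)
    moreover have "(a' - a) * (b - b') < 0" using ab by (simp add: mult_pos_neg)
    ultimately show "timelike (c' s)"
      unfolding timelike_def c'_def using k by (simp add: mult_pos_neg)
  qed
  ultimately show ?thesis using assms(2) unfolding cauchy_surface_def by blast
qed

section \<open>The net of observables\<close>

text \<open>
  The points at which the detour through the smaller causal subset leaves and rejoins the past boundary
  of the larger one are the kinks of the lowest paths joining their corners.
\<close>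
lemma inclusion_kinks:
  assumes "weakly_right p p'" "weakly_right p' q'" "weakly_right q' q"
  shows "(THE u. u \<in> closed_segment p (low_corner p q) \<and> up_right u p') = low_corner p p'"
    and "(THE v. v \<in> closed_segment (low_corner p q) q \<and> down_right q' v) = low_corner q' q"
proof -
  have "weakly_right p q" using assms weakly_right_trans by blast
  note m = low_corner_lightlike[OF this]
  note s = closed_segment_down_right[OF m(1)] closed_segment_up_right[OF m(2)]
  show "(THE u. u \<in> closed_segment p (low_corner p q) \<and> up_right u p') = low_corner p p'"
  proof (rule the_equality)
    show "low_corner p p' \<in> closed_segment p (low_corner p q) \<and> up_right (low_corner p p') p'"
      using assms unfolding s down_right_iff up_right_iff weakly_right_def low_corner_null_coordinates
      by linarith
    show "u = low_corner p p'" if "u \<in> closed_segment p (low_corner p q) \<and> up_right u p'" for u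
    proof (rule null_coordinates_eqI)
      show "fst u + snd u = fst (low_corner p p') + snd (low_corner p p')"
        "fst u - snd u = fst (low_corner p p') - snd (low_corner p p')"
        using that unfolding s down_right_iff up_right_iff low_corner_null_coordinates by linarith+
    qed
  qed
  show "(THE v. v \<in> closed_segment (low_corner p q) q \<and> down_right q' v) = low_corner q' q"
  proof (rule the_equality)
    show "low_corner q' q \<in> closed_segment (low_corner p q) q \<and> down_right q' (low_corner q' q)"
      using assms unfolding s down_right_iff up_right_iff weakly_right_def low_corner_null_coordinates
      by linarith
    show "v = low_corner q' q" if "v \<in> closed_segment (low_corner p q) q \<and> down_right q' v" for v
    proof (rule null_coordinates_eqI)
      show "fst v + snd v = fst (low_corner q' q) + snd (low_corner q' q)"
        "fst v - snd v = fst (low_corner q' q) - snd (low_corner q' q)"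
        using that unfolding s down_right_iff up_right_iff low_corner_null_coordinates by linarith+
    qed
  qed
qed

text \<open>
  The whiskered region that defines the inclusion map runs from the detour made of three lowest paths
  to the lowest path, so it is the descent of that detour.
\<close>
lemma inclusion_cell:
  assumes "weakly_right p p'" "weakly_right p' q'" "weakly_right q' q"
  defines "m \<equiv> low_corner p q" and "m' \<equiv> low_corner p' q'" and "u \<equiv> low_corner p p'" and "v \<equiv> low_corner q' q"
  defines "\<gamma> \<equiv> polygonal_path [u, p', m', q', v]" and "\<delta> \<equiv> polygonal_path [u, m, v]"
  shows "whisker P2 (polygonal_path [p, u]) (\<gamma>, region_between \<gamma> \<delta>, \<delta>) (polygonal_path [v, q])
    = descent (low_path p p' \<cdot>\<^bsub>P2\<^esub> low_path p' q' \<cdot>\<^bsub>P2\<^esub> low_path q' q)"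
proof -
  have concat: "path_concat (polygonal_path (xs @ [x])) (polygonal_path (x # ys)) = polygonal_path (xs @ x # ys)" for xs x ys
    using polygonal_path_append[of "xs @ [x]" "x # ys"] by simp
  note ends = polygonal_path_start_end
  have "weakly_right p q" using assms weakly_right_trans by blast
  note L = low_corner_lightlike[OF assms(1)] low_corner_lightlike[OF assms(2)] low_corner_lightlike[OF assms(3)]
    low_corner_lightlike[OF \<open>weakly_right p q\<close>]
  note L = L[folded m_def m'_def u_def v_def]
  have um: "down_right u m" and mv: "up_right m v" and mq: "up_right v q"
    using assms(1-3) by (simp_all add: u_def v_def m_def down_right_iff up_right_iff weakly_right_def)
  have \<gamma>: "\<gamma> \<in> P2.homs u v"
    unfolding \<gamma>_def P2_homs_iff using L
    by (auto intro!: lightlike_pathsI simp: ends simp del: polygonal_path.simps)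
  have pu: "polygonal_path [p, u] \<in> P2.homs p u" and vq: "polygonal_path [v, q] \<in> P2.homs v q"
    unfolding P2_homs_iff using L mq
    by (auto intro!: lightlike_pathsI simp: ends simp del: polygonal_path.simps)
  have "low_corner u v = m" unfolding u_def v_def m_def by (intro null_coordinates_eqI) simp_all
  then have \<delta>: "\<delta> = low_path u v" unfolding \<delta>_def low_path_def by simp
  have f: "(\<gamma>, region_between \<gamma> \<delta>, \<delta>) = descent \<gamma>"
    using \<gamma> unfolding \<delta> descent_def P2_homs_iff by (simp add: Let_def)
  have src: "polygonal_path [p, u] \<cdot>\<^bsub>P2\<^esub> \<gamma> \<cdot>\<^bsub>P2\<^esub> polygonal_path [v, q]
      = low_path p p' \<cdot>\<^bsub>P2\<^esub> low_path p' q' \<cdot>\<^bsub>P2\<^esub> low_path q' q"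
    unfolding P2_sel \<gamma>_def low_path_def u_def[symmetric] v_def[symmetric] m'_def[symmetric]
    using concat[of "[p]" u "[p', m', q', v]"] concat[of "[p, u, p', m', q']" v "[q]"]
      concat[of "[p, u]" p' "[m', q']"] concat[of "[p, u, p', m']" q' "[v, q]"]
    by (simp del: polygonal_path.simps)
  have tgt: "polygonal_path [p, u] \<cdot>\<^bsub>P2\<^esub> low_path u v \<cdot>\<^bsub>P2\<^esub> polygonal_path [v, q] = low_path p q"
  proof -
    have "polygonal_path [p, u] \<cdot>\<^bsub>P2\<^esub> low_path u v \<cdot>\<^bsub>P2\<^esub> polygonal_path [v, q]
        = polygonal_path [p, u, m, v, q]"
      unfolding P2_sel \<delta>[symmetric] \<delta>_def
      using concat[of "[p]" u "[m, v]"] concat[of "[p, u, m]" v "[q]"]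
      by (simp del: polygonal_path.simps)
    also have "\<dots> = polygonal_path [p, m, v, q]"
      using L um by (intro polygonal_path_insert) (simp add: closed_segment_down_right)
    also have "\<dots> = path_concat (p, closed_segment p m, m) (polygonal_path [m, v, q])"
      by simp
    also have "polygonal_path [m, v, q] = polygonal_path [m, q]"
      using L mv mq by (intro polygonal_path_insert) (simp add: closed_segment_up_right)
    finally show ?thesis unfolding low_path_def m_def[symmetric] by simp
  qed
  note cell = P2.hom2_whisker[OF pu descent_hom2[OF \<gamma>] vq, unfolded src tgt]
  have "low_path p p' \<cdot>\<^bsub>P2\<^esub> low_path p' q' \<cdot>\<^bsub>P2\<^esub> low_path q' q \<in> P2.homs p q"
    using P2.hom2_parallel(1)[OF cell] .
  from P2_hom2_unique[OF cell descent_hom2[OF this]] show ?thesis unfolding f .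
qed

lemma (in strict_2_category) End_monoid_monoid:
  assumes "h \<in> arrs C"
  shows "monoid (End_monoid C h)"
  by (rule monoidI)
    (use assms in \<open>auto simp: End_monoid_def vcomp_closed src2_vcomp tgt2_vcomp id2_closed src2_id2 tgt2_id2
       vcomp_assoc vcomp_id2_left vcomp_id2_right dest: vcomp_id2_left vcomp_id2_right\<close>)

context extended_field_theory
begin

lemma AZ_incl_transport:
  assumes "causal_subset U'" "causal_subset U" "U' \<subseteq> U"
  shows "AZ_incl C Z U' U = transport (low_path (left_corner U) (left_corner U')) (low_path (right_corner U') (right_corner U))"
proof
  fix a
  let ?p = "left_corner U" and ?q = "right_corner U" and ?p' = "left_corner U'" and ?q' = "right_corner U'"
  note r = causal_subset_mono_corners(1)[OF assms] causal_subset_corners(2)[OF assms(1)]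
    causal_subset_mono_corners(2)[OF assms]
  show "AZ_incl C Z U' U a = transport (low_path ?p ?p') (low_path ?q' ?q) a"
    unfolding AZ_incl_def Let_def causal_subset_corners(3)[OF assms(1)] causal_subset_corners(3)[OF assms(2)]
      inclusion_kinks[OF r] inclusion_cell[OF r] low_path_def[symmetric]
      transport_eq[OF low_path_homs[OF r(1)] low_path_homs[OF r(3)] r(2)] conjugate_def ..
qed

lemma algebra_AZ:
  assumes "causal_subset U"
  shows "carrier (algebra (AZ C Z) U) = observables (left_corner U) (right_corner U)"
    and "mult (algebra (AZ C Z) U) = vcomp C"
    and "one (algebra (AZ C Z) U) = id2 C (on_arrs Z (low_path (left_corner U) (right_corner U)))"
  using Z_homs[OF low_path_homs[OF causal_subset_corners(2)[OF assms]]]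
  by (auto simp: AZ_def End_monoid_def past_boundary_low_path[OF assms] hom2_def)

text \<open>Serves both injectivity and the time slice axiom.\<close>
lemma incl_AZ_bij:
  assumes "causal_subset U'" "causal_subset U" "U' \<subseteq> U"
  shows "bij_betw (incl (AZ C Z) U' U) (carrier (algebra (AZ C Z) U')) (carrier (algebra (AZ C Z) U))"
  using transport_bij[OF low_path_homs low_path_homs] causal_subset_mono_corners[OF assms]
    causal_subset_corners(2)[OF assms(1)]
  by (simp add: algebra_AZ assms(1,2)) (simp add: AZ_def AZ_incl_transport[OF assms])

lemma AZ_functor: "functor_to_monoids (AZ C Z)"
proof (rule functor_to_monoids.intro)
  fix U assume U: "causal_subset U"
  have "on_arrs Z (past_boundary U) \<in> arrs C"
    using on_arrs_closed low_path_lightlike[OF causal_subset_corners(2)[OF U]]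
    by (simp add: past_boundary_low_path[OF U] P2_sel)
  then show "monoid (algebra (AZ C Z) U)" by (simp add: AZ_def End_monoid_monoid)
next
  fix U' U assume U: "causal_subset U'" "causal_subset U" "U' \<subseteq> U"
  note r = causal_subset_mono_corners(1)[OF U] causal_subset_corners(2)[OF U(1)]
    causal_subset_mono_corners(2)[OF U]
  note l = low_path_homs[OF r(1)] low_path_homs[OF r(3)] r(2)
  have i: "incl (AZ C Z) U' U = transport (low_path (left_corner U) (left_corner U')) (low_path (right_corner U') (right_corner U))"
    using AZ_incl_transport[OF U] by (simp add: AZ_def)
  show "incl (AZ C Z) U' U \<in> hom (algebra (AZ C Z) U') (algebra (AZ C Z) U)"
    using transport_mult[OF l] transport_closed[OF l]
    by (auto simp: hom_def i algebra_AZ[OF U(1)] algebra_AZ[OF U(2)])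
  show "incl (AZ C Z) U' U \<one>\<^bsub>algebra (AZ C Z) U'\<^esub> = \<one>\<^bsub>algebra (AZ C Z) U\<^esub>"
    using transport_one[OF l] by (simp add: i algebra_AZ[OF U(1)] algebra_AZ[OF U(2)])
next
  fix U a assume "causal_subset U" "a \<in> carrier (algebra (AZ C Z) U)"
  then show "incl (AZ C Z) U U a = a"
    using transport_refl causal_subset_corners(2) AZ_incl_transport[of U U] algebra_AZ(1)
    by (simp add: AZ_def)
next
  fix U'' U' U a
  assume U: "causal_subset U''" "causal_subset U'" "causal_subset U" "U'' \<subseteq> U'" "U' \<subseteq> U"
    and a: "a \<in> carrier (algebra (AZ C Z) U'')"
  note U3 = order_trans[OF U(4,5)]
  let ?p = left_corner and ?q = right_corner
  note r = causal_subset_mono_corners[OF U(2,3,5)] causal_subset_mono_corners[OF U(1,2,4)] causal_subset_corners(2)[OF U(1)]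
  note h = r(1-4)[THEN low_path_homs]
  have "transport (low_path (?p U) (?p U')) (low_path (?q U') (?q U))
      (transport (low_path (?p U') (?p U'')) (low_path (?q U'') (?q U')) a)
    = transport (low_path (?p U) (?p U'')) (low_path (?q U'') (?q U)) a"
    using transport_transport[OF h(1,3,4,2) r(5)] a
      transport_independent[OF P2.homs_comp[OF h(1,3)] P2.homs_comp[OF h(4,2)] r(5)]
    by (simp add: algebra_AZ[OF U(1)])
  then show "incl (AZ C Z) U' U (incl (AZ C Z) U'' U' a) = incl (AZ C Z) U'' U a"
    using AZ_incl_transport[OF U(1,2,4)] AZ_incl_transport[OF U(2,3,5)] AZ_incl_transport[OF U(1,3) U3]
    by (simp add: AZ_def)
qed

lemma AZ_commute:
  assumes U: "causal_subset U1" "causal_subset U2" "causal_subset U" "U1 \<subseteq> U" "U2 \<subseteq> U"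
    and right: "weakly_right (right_corner U1) (left_corner U2)"
    and "a \<in> carrier (algebra (AZ C Z) U1)" "b \<in> carrier (algebra (AZ C Z) U2)"
  shows "incl (AZ C Z) U1 U a \<otimes>\<^bsub>algebra (AZ C Z) U\<^esub> incl (AZ C Z) U2 U b
    = incl (AZ C Z) U2 U b \<otimes>\<^bsub>algebra (AZ C Z) U\<^esub> incl (AZ C Z) U1 U a"
  using transports_commute[OF causal_subset_mono_corners(1)[OF U(1,3,4)] causal_subset_corners(2)[OF U(1)] right
      causal_subset_corners(2)[OF U(2)] causal_subset_mono_corners(2)[OF U(2,3,5)]]
    AZ_incl_transport[OF U(1,3,4)] AZ_incl_transport[OF U(2,3,5)] assms(7,8)
  by (simp add: algebra_AZ[OF U(1)] algebra_AZ[OF U(2)] algebra_AZ[OF U(3)]) (simp add: AZ_def)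

lemma AZ_local_net: "net_of_local_monoids (AZ C Z)"
proof (intro net_of_local_monoids.intro net_of_monoids.intro AZ_functor
    net_of_monoids_axioms.intro net_of_local_monoids_axioms.intro)
  show "inj_on (incl (AZ C Z) U' U) (carrier (algebra (AZ C Z) U'))"
    if "causal_subset U'" "causal_subset U" "U' \<subseteq> U" for U' U
    using incl_AZ_bij[OF that] by (rule bij_betw_imp_inj_on)
  show "incl (AZ C Z) U1 U a \<otimes>\<^bsub>algebra (AZ C Z) U\<^esub> incl (AZ C Z) U2 U b
      = incl (AZ C Z) U2 U b \<otimes>\<^bsub>algebra (AZ C Z) U\<^esub> incl (AZ C Z) U1 U a"
    if "causal_subset U1" "causal_subset U2" "causal_subset U" "U1 \<subseteq> U" "U2 \<subseteq> U"
      "spacelike_separated U1 U2" "a \<in> carrier (algebra (AZ C Z) U1)" "b \<in> carrier (algebra (AZ C Z) U2)"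
    for U1 U2 U a b
    using spacelike_separated_cases[OF that(1,2,6)]
      AZ_commute[OF that(1-5) _ that(7,8)] AZ_commute[OF that(2,1,3,5,4) _ that(8,7)] by argo
qed

lemma AZ_time_slice: "time_slice_axiom (AZ C Z)"
  unfolding time_slice_axiom_def
proof (intro allI impI, elim conjE)
  fix U S \<U>
  assume U: "causal_subset U" "cauchy_surface U S" "\<forall>U'\<in>\<U>. causal_subset U' \<and> U' \<subseteq> U" "S \<subseteq> \<Union>\<U>"
  have "\<U> \<noteq> {}" using cauchy_surface_nonempty[OF U(1,2)] U(4) by blast
  moreover have "incl (AZ C Z) U' U ` carrier (algebra (AZ C Z) U') = carrier (algebra (AZ C Z) U)"
    if "U' \<in> \<U>" for U'
    using incl_AZ_bij[of U' U] U that by (simp add: bij_betw_def)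
  ultimately show "(\<Union>U'\<in>\<U>. incl (AZ C Z) U' U ` carrier (algebra (AZ C Z) U')) = carrier (algebra (AZ C Z) U)"
    by simp
qed

end

theorem theorem1:
  fixes C :: "('o, 'a, 'c) two_category"
    and Z :: "(event, path, path_region, 'o, 'a, 'c) two_functor"
  assumes "strict_2_groupoid C"
    and "strict_2_functor P2 C Z"
  shows "net_of_local_monoids (AZ C Z) \<and> time_slice_axiom (AZ C Z)"
proof -
  interpret extended_field_theory C Z
    using assms by (rule extended_field_theory.intro)
  show ?thesis using AZ_local_net AZ_time_slice ..
qed

end
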